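(* Let $p$ be a prime number and let $w$ be a nonempty finite word over $[\![p]\!]=\{0,1,\dots,p-1\}$. Then the sequence $(a_{p;w}(n))_{n\in\mathbf N}$ is $p$-uniformly morphic. Moreover, if $|w|=1$ and $w\neq 0$ (i.e. $w$ is a single nonzero letter), this sequence is purely morphic; otherwise it is not purely morphic.
   Context: For an integer $m\ge 2$, $[\![m]\!]=\{0,1,\dots,m-1\}$. For $n\ge 0$, $[n]_m$ denotes the base-$m$ expansion of $n$, a word over $[\![m]\!]$ without leading zeros, with the convention $[0]_m=0$ (the one-letter word). For a nonempty word $w$ over $[\![m]\!]$, $e_{m;w}(n)$ is the number of occurrences of $w$ as a factor (contiguous block, occurrences counted at every starting position) of $[n]_m$, and $a_{m;w}(n)\in[\![m]\!]$ is defined by $a_{m;w}(n)\equiv e_{m;w}(n) \pmod m$. A morphism $\phi:B^*\to B^*$ is non-erasing if $\phi(b)$ is nonempty for all letters $b$, and $k$-uniform if $|\phi(b)|=k$ for every letter $b$; a coding is a letter-to-letter map. An infinite sequence $a$ over an alphabet $A$ is morphic if there exist an alphabet $B$, an infinite sequence $b$ over $B$, a non-erasing morphism $\phi:B^*\to B^*$ (extended to infinite words) with $\phi(b)=b$, and a coding $\psi:B\to A$ with $a=\psi(b)$; it is $k$-uniformly morphic if moreover $\phi$ can be taken $k$-uniform; it is purely morphic if one can take $B=A$ and $\psi$ the identity, i.e. $a$ is a fixed point of a non-erasing morphism $A^*\to A^*$. Here $A=[\![p]\!]$.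
   Formalization: Since the identity morphism is non-erasing and fixes every sequence, "purely morphic" is taken to mean: fixed point of a non-erasing morphism of the alphabet that is not the identity on the letters occurring in the sequence; otherwise the negative claim would be false. *)

theory Defs
  imports "HOL-Library.Stream" "HOL-Computational_Algebra.Primes"
begin

definition alphabet :: "nat \<Rightarrow> nat set" where
  "alphabet m = {0..<m}"

text \<open>Base-\<open>m\<close> expansion, most significant digit first, with \<open>0\<close> written as the word \<open>[0]\<close>.
  It is meaningful for \<open>m \<ge> 2\<close>; the guard \<open>m < 2\<close> only makes the recursion terminate.\<close>

fun base_expansion :: "nat \<Rightarrow> nat \<Rightarrow> nat list" where
  "base_expansion m n =
     (if n < m \<or> m < 2 then [n] else base_expansion m (n div m) @ [n mod m])"

declare base_expansion.simps [simp del]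

definition factor_count :: "'a list \<Rightarrow> 'a list \<Rightarrow> nat" where
  "factor_count w u = card {i. i + length w \<le> length u \<and> take (length w) (drop i u) = w}"

definition block_count :: "nat \<Rightarrow> nat list \<Rightarrow> nat \<Rightarrow> nat" where
  "block_count m w n = factor_count w (base_expansion m n)"

definition block_seq :: "nat \<Rightarrow> nat list \<Rightarrow> nat stream" where
  "block_seq m w = smap (\<lambda>n. block_count m w n mod m) nats"

text \<open>A morphism of \<open>B\<^sup>*\<close> is given by the images of the letters.  For a non-erasing morphism,
  \<open>flat (smap \<phi> b)\<close> is its extension to the infinite word \<open>b\<close>.\<close>

definition nonerasing_morphism :: "'b set \<Rightarrow> ('b \<Rightarrow> 'b list) \<Rightarrow> bool" where
  "nonerasing_morphism B \<phi> \<longleftrightarrow> (\<forall>c\<in>B. \<phi> c \<noteq> [] \<and> set (\<phi> c) \<subseteq> B)"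

definition uniform_morphism :: "nat \<Rightarrow> 'b set \<Rightarrow> ('b \<Rightarrow> 'b list) \<Rightarrow> bool" where
  "uniform_morphism k B \<phi> \<longleftrightarrow> (\<forall>c\<in>B. length (\<phi> c) = k)"

definition fixed_point :: "'b set \<Rightarrow> ('b \<Rightarrow> 'b list) \<Rightarrow> 'b stream \<Rightarrow> bool" where
  "fixed_point B \<phi> b \<longleftrightarrow> sset b \<subseteq> B \<and> flat (smap \<phi> b) = b"

text \<open>The auxiliary alphabet \<open>B\<close> is an arbitrary finite alphabet; up to renaming of letters it is a
  finite set of natural numbers.\<close>

definition uniformly_morphic :: "nat \<Rightarrow> 'a set \<Rightarrow> 'a stream \<Rightarrow> bool" where
  "uniformly_morphic k A a \<longleftrightarrow>
     (\<exists>(B :: nat set) (b :: nat stream) \<phi> \<psi>.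
        finite B \<and> nonerasing_morphism B \<phi> \<and> uniform_morphism k B \<phi> \<and> fixed_point B \<phi> b \<and>
        \<psi> ` B \<subseteq> A \<and> a = smap \<psi> b)"

text \<open>The identity morphism fixes every infinite word, so the notion is vacuous unless it is
  excluded.  The last conjunct does exactly that: \<open>\<phi>\<close> must not be the identity on the letters
  occurring in \<open>a\<close>.\<close>

definition purely_morphic :: "'a set \<Rightarrow> 'a stream \<Rightarrow> bool" where
  "purely_morphic A a \<longleftrightarrow>
     finite A \<and>
     (\<exists>\<phi>. nonerasing_morphism A \<phi> \<and> fixed_point A \<phi> a \<and> (\<exists>c\<in>sset a. \<phi> c \<noteq> [c]))"

end

theory Submission
  imports Defs
begin

text \<open>Write \<open>A n\<close> for the number of occurrences of \<open>w\<close> in \<open>n\<close> and \<open>k\<close> for the length of \<open>w\<close>.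
  Appending a digit gives \<open>A (p * n + r) = A n + 1\<close> or \<open>A n\<close> according to whether the last
  \<open>k\<close> digits are \<open>w\<close>, so the pair of \<open>A n mod p\<close> and the last digits of \<open>n\<close> is generated by a
  \<open>p\<close>-uniform morphism; for a single nonzero letter \<open>A n mod p\<close> alone suffices.

  If the sequence were a fixed point of a non-trivial morphism, powers of the morphism would turn
  a repetition in the sequence into repetitions of arbitrarily long period \<open>L\<close>.
  For \<open>k \<ge> 2\<close> every letter has a run of length \<open>p + 1\<close>, which yields a period \<open>L\<close> on an interval of
  length \<open>(p + 1) * L\<close>.  If \<open>p\<close> divides \<open>L\<close>, the recurrence passes this period to \<open>L div p\<close> and forces
  \<open>p ^ (k - 1)\<close> to divide \<open>L div p\<close>, which gives an infinite descent.  If \<open>p\<close> does not divide \<open>L\<close>, the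
  shifts by multiples of \<open>L\<close> reach all residues modulo \<open>p\<close>, and comparing the differences
  \<open>A (i + 1) - A i\<close> in these residue classes gives a contradiction.
  For \<open>w = 0\<close> such repetitions do occur, and the obstruction is the beginning of the sequence, where
  the missing leading zeros are incompatible with a long period.\<close>

section \<open>Base expansions and block counts\<close>

definition digits_value :: "nat \<Rightarrow> nat list \<Rightarrow> nat" where
  "digits_value m ds = foldl (\<lambda>x d. m * x + d) 0 ds"

lemma digits_value_Nil [simp]: "digits_value m [] = 0"
  by (simp add: digits_value_def)

lemma digits_value_snoc [simp]: "digits_value m (ds @ [d]) = m * digits_value m ds + d"
  by (simp add: digits_value_def)

lemma digits_value_append:
  "digits_value m (us @ vs) = digits_value m us * m ^ length vs + digits_value m vs"
proof (induction vs rule: rev_induct)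
  case (snoc d vs)
  have "digits_value m (us @ vs @ [d]) = m * digits_value m (us @ vs) + d"
    using digits_value_snoc [of m "us @ vs" d] by simp
  then show ?case
    using snoc by (simp add: algebra_simps)
qed simp

lemma digits_value_less:
  "set ds \<subseteq> {0..<m} \<Longrightarrow> digits_value m ds < m ^ length ds"
proof (induction ds rule: rev_induct)
  case (snoc d ds)
  then have "Suc (digits_value m ds) \<le> m ^ length ds" and d: "d < m"
    by auto
  then have "m * Suc (digits_value m ds) \<le> m * m ^ length ds"
    by (intro mult_le_mono2)
  then show ?case
    using d by simp
qed simp

lemma digits_value_inject:
  assumes "length us = length vs" "set us \<subseteq> {0..<m}" "set vs \<subseteq> {0..<m}"
    and "digits_value m us = digits_value m vs"
  shows "us = vs"
  using assms
proof (induction us arbitrary: vs rule: rev_induct)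
  case (snoc d us)
  then obtain e vs' where vs: "vs = vs' @ [e]"
    by (metis length_0_conv rev_exhaust snoc_eq_iff_butlast)
  have d: "d < m" "e < m"
    using snoc.prems vs by auto
  have eq: "m * digits_value m us + d = m * digits_value m vs' + e"
    using snoc.prems vs by simp
  have "(m * digits_value m us + d) div m = digits_value m us"
    "(m * digits_value m vs' + e) div m = digits_value m vs'"
    using d by auto
  then have "digits_value m us = digits_value m vs'"
    using eq by simp
  then show ?case
    using snoc vs eq by auto
qed simp

text \<open>Turns the comparison of digit lists into a congruence, so that later arguments work with
  residues instead of expansions.\<close>

lemma digits_value_suffix_eq_iff:
  assumes "set us \<subseteq> {0..<m}" "set w \<subseteq> {0..<m}" "length w \<le> length us"
  shows "drop (length us - length w) us = w
    \<longleftrightarrow> digits_value m us mod m ^ length w = digits_value m w"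
proof -
  define v where "v = drop (length us - length w) us"
  have len: "length v = length w"
    using assms by (simp add: v_def)
  have v: "set v \<subseteq> {0..<m}"
    using assms set_drop_subset unfolding v_def by fast
  have "digits_value m us = digits_value m (take (length us - length w) us @ v)"
    by (simp add: v_def)
  then have "digits_value m us mod m ^ length w = digits_value m v"
    using digits_value_less [OF v] len by (simp add: digits_value_append)
  moreover have "v = w \<longleftrightarrow> digits_value m v = digits_value m w"
    using digits_value_inject [OF len v assms(2)] by auto
  ultimately show ?thesis
    by (simp add: v_def)
qed

lemma base_expansion_less: "n < m \<Longrightarrow> base_expansion m n = [n]"
  by (simp add: base_expansion.simps)

lemma base_expansion_ge:
  "2 \<le> m \<Longrightarrow> m \<le> n \<Longrightarrow> base_expansion m n = base_expansion m (n div m) @ [n mod m]"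
  by (subst base_expansion.simps) simp

lemma base_expansion_correct:
  assumes "2 \<le> m"
  shows "set (base_expansion m n) \<subseteq> {0..<m} \<and> digits_value m (base_expansion m n) = n"
proof (induction n rule: less_induct)
  case (less n)
  show ?case
  proof (cases "n < m")
    case True
    then show ?thesis
      by (simp add: base_expansion_less digits_value_def)
  next
    case False
    with assms have "n div m < n"
      by simp
    from less.IH [OF this] show ?thesis
      using False assms by (simp add: base_expansion_ge)
  qed
qed

lemma length_base_expansion:
  assumes "2 \<le> m" "0 < n"
  shows "Suc j \<le> length (base_expansion m n) \<longleftrightarrow> m ^ j \<le> n"
  using assms(2)
proof (induction n arbitrary: j rule: less_induct)
  case (less n)
  show ?case
  proof (cases "n < m")
    case True
    show ?thesis
    proof (cases j)
      case (Suc i)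
      have "m * 1 \<le> m * m ^ i"
        using assms by (intro mult_le_mono2) simp
      then have "\<not> m * m ^ i \<le> n"
        using True by linarith
      then show ?thesis
        using True Suc by (simp add: base_expansion_less)
    qed (use True less.prems in \<open>simp add: base_expansion_less\<close>)
  next
    case False
    with assms have lt: "n div m < n" "0 < n div m"
      by (auto simp: div_greater_zero_iff)
    show ?thesis
    proof (cases j)
      case (Suc i)
      have "m ^ i \<le> n div m \<longleftrightarrow> m * m ^ i \<le> n"
        using assms by (subst less_eq_div_iff_mult_less_eq) (auto simp: mult.commute)
      then show ?thesis
        using less.IH [OF lt, of i] Suc False assms by (simp add: base_expansion_ge)
    qed (use False assms less.prems in \<open>simp add: base_expansion_ge\<close>)
  qed
qed

text \<open>An occurrence gained by appending a letter must end at that letter, so at most one is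
  gained.\<close>

lemma factor_count_snoc:
  assumes "w \<noteq> []"
  shows "factor_count w (us @ [d]) = factor_count w us +
    of_bool (length w \<le> Suc (length us) \<and> drop (Suc (length us) - length w) (us @ [d]) = w)"
proof -
  let ?S = "\<lambda>u. {i. i + length w \<le> length u \<and> take (length w) (drop i u) = w}"
  let ?j = "Suc (length us) - length w"
  let ?c = "length w \<le> Suc (length us) \<and> drop ?j (us @ [d]) = w"
  have fin: "finite (?S us)"
    by (rule finite_subset [of _ "{..length us}"]) auto
  have "?S (us @ [d]) = ?S us \<union> (if ?c then {?j} else {})"
  proof (rule set_eqI)
    fix i
    consider "i + length w \<le> length us" | "i + length w = Suc (length us)"
      | "i + length w > Suc (length us)"
      by linarith
    then show "i \<in> ?S (us @ [d]) \<longleftrightarrow> i \<in> ?S us \<union> (if ?c then {?j} else {})"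
    proof cases
      case 1
      then show ?thesis
        using assms by (auto simp: Suc_diff_le)
    next
      case 2
      then have "i = ?j"
        by simp
      then show ?thesis
        using 2 by auto
    next
      case 3
      then show ?thesis
        by auto
    qed
  qed
  moreover have "?j \<notin> ?S us"
    using assms by (cases w) auto
  ultimately show ?thesis
    unfolding factor_count_def using fin by (auto simp: card_insert_if)
qed

lemma block_count_less:
  assumes "n < m" "w \<noteq> []"
  shows "block_count m w n = of_bool (w = [n])"
proof -
  have "factor_count w ([] @ [n]) = of_bool (w = [n])"
    using assms(2) by (subst factor_count_snoc) (cases w; auto simp: factor_count_def)+
  then show ?thesis
    using assms(1) by (simp add: block_count_def base_expansion_less)
qed

text \<open>The lower bound in the indicator says that \<open>n\<close> has at least
  \<open>length w\<close> digits. Without it a word with leading zeros would match zeros that the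
  expansion does not contain.\<close>

lemma block_count_ge:
  assumes "2 \<le> m" "m \<le> n" "w \<noteq> []" "set w \<subseteq> {0..<m}"
  shows "block_count m w n = block_count m w (n div m) +
    of_bool (m ^ (length w - 1) \<le> n \<and> n mod m ^ length w = digits_value m w)"
proof -
  let ?u = "base_expansion m n"
  have u: "?u = base_expansion m (n div m) @ [n mod m]"
    using assms by (simp add: base_expansion_ge)
  have len: "length w \<le> length ?u \<longleftrightarrow> m ^ (length w - 1) \<le> n"
    using length_base_expansion [of m n "length w - 1"] assms by (cases w) auto
  have suffix: "drop (length ?u - length w) ?u = w \<longleftrightarrow> n mod m ^ length w = digits_value m w"
    if "length w \<le> length ?u"
    using digits_value_suffix_eq_iff [of ?u m w] base_expansion_correct [of m n] assms that
    by simp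
  have "factor_count w ?u = factor_count w (base_expansion m (n div m)) +
    of_bool (length w \<le> length ?u \<and> drop (length ?u - length w) ?u = w)"
    unfolding u by (subst factor_count_snoc [OF assms(3)]) simp
  then show ?thesis
    using len suffix by (auto simp: block_count_def)
qed

section \<open>Uniform morphisms\<close>

lemma flat_snth_sum:
  assumes "\<And>i. s !! i \<noteq> []" "j < length (s !! n)"
  shows "flat s !! ((\<Sum>i<n. length (s !! i)) + j) = s !! n ! j"
  using assms
proof (induction n arbitrary: s)
  case 0
  then have "shd s \<noteq> []" "j < length (shd s)"
    by (metis snth.simps(1))+
  then show ?case
    by (simp add: flat_unfold shift_snth)
next
  case (Suc n)
  have "\<And>i. stl s !! i \<noteq> []" "j < length (stl s !! n)"
    using Suc.prems by (metis snth.simps(2))+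
  note IH = Suc.IH [OF this]
  have "(\<Sum>i<Suc n. length (s !! i)) = length (shd s) + (\<Sum>i<n. length (stl s !! i))"
    by (simp add: sum.lessThan_Suc_shift del: sum.lessThan_Suc)
  moreover have "shd s \<noteq> []"
    using Suc.prems(1) [of 0] by simp
  ultimately show ?case
    using IH by (simp add: flat_unfold shift_snth)
qed

text \<open>The letters of \<open>b\<close> carry enough information to determine the block of \<open>p\<close> letters that
  replaces them, so the block read off any occurrence of a letter defines the morphism.\<close>

lemma uniform_fixed_point:
  fixes b :: "nat \<Rightarrow> 'a"
  assumes "0 < p"
    and cong: "\<And>m n r. b m = b n \<Longrightarrow> r < p \<Longrightarrow> b (p * m + r) = b (p * n + r)"
    and B: "range b \<subseteq> B"
  obtains \<phi> where "nonerasing_morphism B \<phi>" "uniform_morphism p B \<phi>"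
    "fixed_point B \<phi> (smap b nats)"
proof
  \<comment> \<open>A letter of \<open>B\<close> outside the range of \<open>b\<close> gets the
    block at an arbitrary index, which also has length \<open>p\<close> and lies in
    \<open>B\<close>.\<close>
  define \<phi> where "\<phi> c = map (\<lambda>r. b (p * (SOME n. b n = c) + r)) [0..<p]" for c
  have \<phi>: "\<phi> (b n) = map (\<lambda>r. b (p * n + r)) [0..<p]" for n
  proof -
    have "b (SOME n'. b n' = b n) = b n"
      by (rule someI [of _ n]) simp
    then show ?thesis
      unfolding \<phi>_def by (intro map_cong refl cong) auto
  qed
  show "nonerasing_morphism B \<phi>" "uniform_morphism p B \<phi>"
    using assms(1) B by (auto simp: nonerasing_morphism_def uniform_morphism_def \<phi>_def)
  let ?s = "smap \<phi> (smap b nats)"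
  have "flat ?s !! n = smap b nats !! n" for n
  proof -
    have "flat ?s !! ((\<Sum>i<n div p. length (?s !! i)) + n mod p) = ?s !! (n div p) ! (n mod p)"
      using assms(1) by (intro flat_snth_sum) (simp_all add: \<phi>)
    then show ?thesis
      using assms(1) by (simp add: \<phi> mult.commute)
  qed
  then have "snth (flat ?s) = snth (smap b nats)"
    by (rule ext)
  then have "smap (snth (flat ?s)) nats = smap (snth (smap b nats)) nats"
    by (simp only:)
  then have "flat ?s = smap b nats"
    by (simp only: stream_smap_nats [symmetric])
  then show "fixed_point B \<phi> (smap b nats)"
    using B by (auto simp: fixed_point_def stream.set_map)
qed

lemma block_seq_uniformly_morphic:
  assumes "2 \<le> p" "w \<noteq> []" "set w \<subseteq> {0..<p}"
  shows "uniformly_morphic p (alphabet p) (block_seq p w)"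
proof -
  let ?P = "p ^ length w"
  have pos: "0 < p"
    using assms(1) by simp
  define A where "A = block_count p w"
  \<comment> \<open>Below \<open>?P\<close> the number itself is stored, since digits may be missing
    there. From \<open>?P\<close> on the last \<open>length w\<close> digits suffice, and the offset
    \<open>?P\<close> keeps the two kinds of letters apart.\<close>
  define \<tau> where "\<tau> n = (if n < ?P then n else ?P + n mod ?P)" for n
  define b where "b n = prod_encode (\<tau> n, A n mod p)" for n
  have P: "p \<le> ?P" "p ^ (length w - 1) \<le> ?P"
    using assms by (cases w; simp)+
  have cong: "b (p * m + r) = b (p * n + r)" if "b m = b n" "r < p" for m n r
  proof (cases "m < ?P \<or> n < ?P")
    case True
    have "\<tau> m = \<tau> n"
      using that by (simp add: b_def)
    with True have "m = n"
      by (auto simp: \<tau>_def split: if_splits)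
    then show ?thesis
      by simp
  next
    case False
    then have mn: "m mod ?P = n mod ?P" "A m mod p = A n mod p"
      using that(1) by (auto simp: b_def \<tau>_def)
    have mod: "(p * m + r) mod ?P = (p * n + r) mod ?P"
      using mn(1) by (metis mod_add_left_eq mod_mult_right_eq)
    have ge: "x \<le> p * x + r" for x
      using assms(1) by (simp add: trans_le_add1)
    have A: "A (p * x + r) = A x + of_bool ((p * x + r) mod ?P = digits_value p w)"
      if "?P \<le> x" for x
    proof -
      have "p \<le> p * x + r" "p ^ (length w - 1) \<le> p * x + r"
        using ge [of x] P that by linarith+
      then show ?thesis
        using assms \<open>r < p\<close> by (simp add: A_def block_count_ge)
    qed
    have "A (p * m + r) mod p = A (p * n + r) mod p"
      using False mod mod_add_cong [OF mn(2) refl] by (simp add: A)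
    moreover have "\<tau> (p * m + r) = \<tau> (p * n + r)"
      using False ge [of m] ge [of n] mod by (simp add: \<tau>_def)
    ultimately show ?thesis
      by (simp add: b_def)
  qed
  obtain \<phi> where \<phi>: "nonerasing_morphism (range b) \<phi>" "uniform_morphism p (range b) \<phi>"
    "fixed_point (range b) \<phi> (smap b nats)"
    using uniform_fixed_point [where b = b, OF pos cong subset_refl] by blast
  have "range b \<subseteq> prod_encode ` ({..<2 * ?P} \<times> {..<p})"
    using assms(1) by (force simp: b_def \<tau>_def intro!: imageI)
  then have "finite (range b)"
    by (rule finite_subset) simp
  moreover have "(snd \<circ> prod_decode) ` range b \<subseteq> alphabet p"
    using assms(1) by (auto simp: b_def alphabet_def)
  moreover have "block_seq p w = smap (snd \<circ> prod_decode) (smap b nats)"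
    by (simp add: block_seq_def stream.map_comp b_def A_def comp_def)
  ultimately show ?thesis
    unfolding uniformly_morphic_def using \<phi> by blast
qed

text \<open>Since \<open>z\<close> is nonzero, the count at \<open>0\<close> is \<open>0\<close> and
  the recurrence holds from \<open>n = 0\<close> on, so the count modulo \<open>p\<close> alone
  determines the next block. Blocks of length \<open>p \<ge> 2\<close> make the morphism
  nontrivial.\<close>

lemma single_letter_purely_morphic:
  assumes "2 \<le> p" "z < p" "z \<noteq> 0"
  shows "purely_morphic (alphabet p) (block_seq p [z])"
proof -
  let ?A = "block_count p [z]"
  have pos: "0 < p"
    using assms(1) by simp
  define a where "a n = ?A n mod p" for n
  have rec: "?A (p * n + r) = ?A n + of_bool (r = z)" if "r < p" for n r
  proof (cases "n = 0")
    case True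
    then show ?thesis
      using that assms by (auto simp: block_count_less)
  next
    case False
    then have "p \<le> p * n + r"
      by (cases n) auto
    then show ?thesis
      using that assms False
      by (simp add: block_count_ge digits_value_def of_bool_def)
  qed
  have cong: "a (p * m + r) = a (p * n + r)" if "a m = a n" "r < p" for m n r
    using that mod_add_cong [of "?A m" p "?A n", OF _ refl] by (simp add: a_def rec)
  have range: "range a \<subseteq> alphabet p"
    using assms by (auto simp: a_def alphabet_def)
  obtain \<phi> where \<phi>: "nonerasing_morphism (alphabet p) \<phi>"
    "uniform_morphism p (alphabet p) \<phi>" "fixed_point (alphabet p) \<phi> (smap a nats)"
    using uniform_fixed_point [where b = a, OF pos cong range] by blast
  have seq: "block_seq p [z] = smap a nats"
    by (simp add: block_seq_def a_def [abs_def])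
  have "length (\<phi> (a 0)) = p"
    using \<phi>(2) assms(1) by (simp add: uniform_morphism_def a_def alphabet_def)
  then have "\<phi> (a 0) \<noteq> [a 0]"
    using assms(1) by auto
  moreover have "a 0 \<in> sset (smap a nats)"
    by (simp add: stream.set_map)
  ultimately show ?thesis
    using \<phi> unfolding purely_morphic_def seq by (auto simp: alphabet_def)
qed

section \<open>Morphisms fixing a sequence\<close>

text \<open>\<open>f n\<close> is the length of the image of the prefix of length \<open>n\<close> under a non-erasing morphism
  that fixes \<open>a\<close>; the morphism itself is recovered from \<open>f\<close> and \<open>a\<close>.\<close>

definition block_map :: "(nat \<Rightarrow> 'a) \<Rightarrow> (nat \<Rightarrow> nat) \<Rightarrow> bool" where
  "block_map a f \<longleftrightarrow> f 0 = 0 \<and> (\<forall>n. f n < f (Suc n)) \<and>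
     (\<forall>m n. a m = a n \<longrightarrow> f (Suc m) - f m = f (Suc n) - f n \<and>
        (\<forall>j < f (Suc m) - f m. a (f m + j) = a (f n + j)))"

lemma block_map_0: "block_map a f \<Longrightarrow> f 0 = 0"
  unfolding block_map_def by (elim conjE)

lemma block_map_less: "block_map a f \<Longrightarrow> f n < f (Suc n)"
  unfolding block_map_def by (elim conjE) (rule spec)

lemma block_map_strict_mono: "block_map a f \<Longrightarrow> strict_mono f"
  by (simp add: block_map_less strict_mono_Suc_iff)

lemma block_map_letter:
  assumes "block_map a f" "a m = a n"
  shows "f (Suc m) + f n = f (Suc n) + f m"
    and "j < f (Suc m) - f m \<Longrightarrow> a (f m + j) = a (f n + j)"
proof -
  have "f (Suc m) - f m = f (Suc n) - f n" "f m < f (Suc m)" "f n < f (Suc n)"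
    using assms unfolding block_map_def by blast+
  then show "f (Suc m) + f n = f (Suc n) + f m"
    by linarith
next
  show "j < f (Suc m) - f m \<Longrightarrow> a (f m + j) = a (f n + j)"
    using assms unfolding block_map_def by blast
qed

lemma block_map_factor:
  assumes "block_map a f" "\<And>j. j < e \<Longrightarrow> a (s + j) = a (t + j)"
  shows "f (s + e) + f t = f (t + e) + f s \<and>
    (\<forall>x < f (s + e) - f s. a (f s + x) = a (f t + x))"
  using assms(2)
proof (induction e)
  case (Suc e)
  then have IH: "f (s + e) + f t = f (t + e) + f s"
      "\<And>x. x < f (s + e) - f s \<Longrightarrow> a (f s + x) = a (f t + x)"
    by auto
  note letter = block_map_letter [OF assms(1) Suc.prems [OF lessI]]
  have mono: "f s \<le> f (s + e)" "f t \<le> f (t + e)"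
    using block_map_strict_mono [OF assms(1)] by (simp_all add: strict_mono_less_eq)
  have "a (f s + x) = a (f t + x)" if x: "x < f (s + Suc e) - f s" for x
  proof (cases "x < f (s + e) - f s")
    case False
    define y where "y = x - (f (s + e) - f s)"
    have "f s + x = f (s + e) + y" "f t + x = f (t + e) + y" "y < f (Suc (s + e)) - f (s + e)"
      using False x IH(1) mono by (auto simp: y_def)
    then show ?thesis
      using letter(2) by simp
  qed (use IH in simp)
  then show ?case
    using IH(1) letter(1) by simp
qed simp

text \<open>The factors starting at \<open>s\<close> and at \<open>s + d\<close> agree, hence so do
  their images. The new period is the length of the image of one old period.\<close>

lemma block_map_period:
  assumes f: "block_map a f" and per: "\<And>i. s \<le> i \<Longrightarrow> i < u \<Longrightarrow> a (i + d) = a i"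
  shows "s \<le> x \<Longrightarrow> x \<le> u \<Longrightarrow> f (x + d) = f x + (f (s + d) - f s)"
    and "f s \<le> i \<Longrightarrow> i < f u \<Longrightarrow> a (i + (f (s + d) - f s)) = a i"
proof -
  have mono: "f m \<le> f n" if "m \<le> n" for m n
    using block_map_strict_mono [OF f] that by (simp add: strict_mono_less_eq)
  have factor: "f (s + e) + f (s + d) = f (s + d + e) + f s \<and>
      (\<forall>x < f (s + e) - f s. a (f s + x) = a (f (s + d) + x))" if "s + e \<le> u" for e
  proof (rule block_map_factor [OF f])
    fix j
    assume "j < e"
    then show "a (s + j) = a (s + d + j)"
      using per [of "s + j"] that by (simp add: add.commute add.left_commute)
  qed
  show "f (x + d) = f x + (f (s + d) - f s)" if "s \<le> x" "x \<le> u"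
    using factor [of "x - s"] that mono [of s "s + d"] by (simp add: add.commute)
  show "a (i + (f (s + d) - f s)) = a i" if i: "f s \<le> i" "i < f u"
  proof -
    have "s \<le> u"
      using i mono [of u s] by (meson leD le_less_trans nat_le_linear)
    then have "\<forall>x < f u - f s. a (f s + x) = a (f (s + d) + x)"
      using factor [of "u - s"] by simp
    moreover have "i - f s < f u - f s"
      using i by simp
    ultimately have "a (f s + (i - f s)) = a (f (s + d) + (i - f s))"
      by blast
    moreover have "f (s + d) + (i - f s) = i + (f (s + d) - f s)"
      using i mono [of s "s + d"] by simp
    ultimately show ?thesis
      using i by simp
  qed
qed

lemma block_map_comp:
  assumes f: "block_map a f" and g: "block_map a g"
  shows "block_map a (f \<circ> g)"
proof -
  have mono: "strict_mono f" "strict_mono g"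
    using assms by (simp_all add: block_map_strict_mono)
  have letter: "f (g (Suc m)) - f (g m) = f (g (Suc n)) - f (g n) \<and>
      (\<forall>j < f (g (Suc m)) - f (g m). a (f (g m) + j) = a (f (g n) + j))" if "a m = a n" for m n
  proof -
    note letter = block_map_letter [OF g that]
    define e where "e = g (Suc m) - g m"
    have lt: "g m < g (Suc m)" "g n < g (Suc n)"
      using mono by (simp_all add: strict_mono_less)
    have e: "g (Suc m) = g m + e" "g (Suc n) = g n + e"
      using lt letter(1) by (auto simp: e_def)
    have "\<And>j. j < e \<Longrightarrow> a (g m + j) = a (g n + j)"
      using letter(2) by (simp add: e_def)
    then have "f (g m + e) + f (g n) = f (g n + e) + f (g m)"
        "\<forall>x < f (g m + e) - f (g m). a (f (g m) + x) = a (f (g n) + x)"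
      using block_map_factor [OF f, of e "g m" "g n"] by blast+
    moreover have "f (g m) \<le> f (g m + e)" "f (g n) \<le> f (g n + e)"
      using mono by (simp_all add: strict_mono_less_eq)
    ultimately show ?thesis
      unfolding e by auto
  qed
  show ?thesis
    unfolding block_map_def comp_apply
  proof (intro conjI [of "f (g 0) = 0"] conjI [of "\<forall>n. f (g n) < f (g (Suc n))"] allI impI)
    show "f (g 0) = 0" "f (g n) < f (g (Suc n))" for n
      using f g mono by (simp_all add: block_map_0 strict_mono_less)
  qed (rule letter)
qed

lemma block_map_funpow: "block_map a f \<Longrightarrow> block_map a (f ^^ m)"
proof (induction m)
  case 0
  then show ?case
    by (simp add: block_map_def)
next
  case (Suc m)
  then show ?case
    using block_map_comp [of a f "f ^^ m"] by (simp add: comp_def)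
qed

lemma block_map_run:
  assumes "block_map a f" "\<And>j. j < e \<Longrightarrow> a (q + j) = a n"
  shows "f (q + e) = f q + e * (f (Suc n) - f n)"
  using assms(2)
proof (induction e)
  case (Suc e)
  then have "f (Suc (q + e)) + f n = f (Suc n) + f (q + e)"
    using block_map_letter(1) [OF assms(1)] by simp
  moreover have "f n < f (Suc n)"
    using assms(1) by (simp add: block_map_0 block_map_less)
  ultimately show ?case
    using Suc by simp
qed simp

text \<open>Each earlier occurrence of the letter contributes one image of the same length to
  \<open>f q\<close>. This pushes a repetition far out in comparison with its period.\<close>

lemma block_map_count_le:
  assumes "block_map a f"
  shows "card {i. i < q \<and> a i = a n} * (f (Suc n) - f n) \<le> f q"
proof (induction q)
  case (Suc q)
  let ?S = "\<lambda>q. {i. i < q \<and> a i = a n}"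
  have lt: "f q < f (Suc q)" "f n < f (Suc n)"
    using assms by (simp_all add: block_map_less)
  show ?case
  proof (cases "a q = a n")
    case True
    then have "?S (Suc q) = insert q (?S q)"
      by auto
    then have "card (?S (Suc q)) = Suc (card (?S q))"
      by simp
    moreover have "f (Suc q) + f n = f (Suc n) + f q"
      using block_map_letter(1) [OF assms True] .
    ultimately show ?thesis
      using Suc lt by simp
  next
    case False
    then have "?S (Suc q) = ?S q"
      by (auto simp: less_Suc_eq)
    then show ?thesis
      using Suc lt by simp
  qed
qed simp

text \<open>The least index whose image is longer than one letter is fixed by \<open>f\<close> and
  by all its powers, while the end of its image tends to infinity under them
  (\<open>funpow_growth\<close>).\<close>

lemma first_growing_letter:
  assumes "block_map a f" "f (Suc n') \<noteq> Suc (f n')"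
  obtains n where "\<And>i. i \<le> n \<Longrightarrow> f i = i" "Suc n < f (Suc n)"
proof
  let ?G = "\<lambda>n. f (Suc n) \<noteq> Suc (f n)"
  define n where "n = (LEAST n. ?G n)"
  have "?G n"
    unfolding n_def using assms(2) by (rule LeastI)
  show fixed: "f i = i" if "i \<le> n" for i
    using that
  proof (induction i)
    case 0
    then show ?case
      using assms(1) by (simp add: block_map_0 block_map_less)
  next
    case (Suc i)
    then show ?case
      using not_less_Least [of i ?G] by (simp add: n_def)
  qed
  have "f n < f (Suc n)"
    using assms(1) by (simp add: block_map_0 block_map_less)
  then show "Suc n < f (Suc n)"
    using \<open>?G n\<close> fixed [of n] by simp
qed

lemma strict_mono_add_le:
  fixes f :: "nat \<Rightarrow> nat"
  assumes "strict_mono f"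
  shows "f x + d \<le> f (x + d)"
proof (induction d)
  case (Suc d)
  have "f (x + d) < f (x + Suc d)"
    using assms by (simp add: strict_mono_less)
  then show ?case
    using Suc by linarith
qed simp

lemma funpow_growth:
  assumes "strict_mono f" "Suc n < f (Suc n)"
  shows "Suc n + m \<le> (f ^^ m) (Suc n)"
proof (induction m)
  case (Suc m)
  define x where "x = (f ^^ m) (Suc n)"
  have x: "Suc n + m \<le> x"
    using Suc x_def by simp
  have "x < f x"
    using strict_mono_add_le [OF assms(1), of "Suc n" "x - Suc n"]
    using x assms(2) by simp
  then show ?case
    using x by (simp add: x_def)
qed simp

lemma funpow_fixed: "f n = n \<Longrightarrow> (f ^^ m) n = n"
  by (induction m) auto

lemma purely_morphic_block_map:
  assumes "purely_morphic A (smap a nats)"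
  obtains f n where "block_map a f" "\<And>i. i \<le> n \<Longrightarrow> f i = i" "Suc n < f (Suc n)"
proof -
  obtain \<phi> c where \<phi>: "nonerasing_morphism A \<phi>" "fixed_point A \<phi> (smap a nats)"
    and c: "c \<in> sset (smap a nats)" "\<phi> c \<noteq> [c]"
    using assms by (auto simp: purely_morphic_def)
  define f where "f n = (\<Sum>i<n. length (\<phi> (a i)))" for n
  have ne: "\<phi> (a i) \<noteq> []" for i
    using \<phi> by (auto simp: nonerasing_morphism_def fixed_point_def stream.set_map)
  have nth: "a (f n + j) = \<phi> (a n) ! j" if "j < length (\<phi> (a n))" for n j
  proof -
    have "flat (smap \<phi> (smap a nats)) !! (f n + j) = \<phi> (a n) ! j"
      using flat_snth_sum [of "smap \<phi> (smap a nats)" j n] ne that by (simp add: f_def)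
    then show ?thesis
      using \<phi>(2) by (simp add: fixed_point_def)
  qed
  have Suc: "f (Suc n) = f n + length (\<phi> (a n))" for n
    by (simp add: f_def)
  have f: "block_map a f"
    unfolding block_map_def
    by (intro conjI allI impI) (use ne nth in \<open>auto simp: Suc f_def\<close>)
  obtain n where n: "c = a n"
    using c(1) by (auto simp: stream.set_map)
  show thesis
  proof (cases "\<exists>n. f (Suc n) \<noteq> Suc (f n)")
    case True
    then show ?thesis
      using first_growing_letter [OF f] that f by blast
  next
    \<comment> \<open>If all images were single letters, \<open>f\<close> would be the identity and
      \<open>\<phi>\<close> would fix every letter of the sequence, contrary to the choice of
      \<open>c\<close>.\<close>
    case False
    have id: "f i = i" for i
      using False by (induction i) (auto simp: f_def)
    then have "length (\<phi> (a n)) = 1"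
      using Suc [of n] by simp
    moreover have "a n = \<phi> (a n) ! 0"
      using nth [of 0 n] ne [of n] id by simp
    ultimately show ?thesis
      using c(2) n by (cases "\<phi> (a n)") auto
  qed
qed

section \<open>Words of length at least two\<close>

lemma ex_residue_in_interval:
  fixes v :: nat
  assumes "v < m"
  shows "\<exists>n. x \<le> n \<and> n < x + m \<and> n mod m = v"
proof (intro exI conjI)
  let ?d = "(v + (m - x mod m)) mod m"
  have "(x + ?d) mod m = (x mod m + (v + (m - x mod m))) mod m"
    by (simp add: mod_simps)
  also have "x mod m + (v + (m - x mod m)) = v + m"
    using assms mod_less_divisor [of m x] by linarith
  finally show "(x + ?d) mod m = v"
    using assms by simp
qed (use assms in auto)

lemma of_bool_eq_if_mod_eq:
  assumes "2 \<le> (p::nat)" "(x + of_bool P) mod p = (z + of_bool R) mod p" "x mod p = z mod p"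
  shows "P \<longleftrightarrow> R"
proof -
  have neq: "Suc u mod p \<noteq> v mod p" if "u mod p = v mod p" for u v
    using that assms(1) mod_Suc [of u p] by (auto split: if_splits)
  show ?thesis
    using assms(2,3) neq [of x z] neq [of z x] by (cases P; cases R) auto
qed

text \<open>Depends only on the letters at \<open>i\<close> and \<open>Suc i\<close>, so periods
  pass to it. Inside a block of \<open>p\<close> indices the unknown common count cancels, which
  leaves an explicit value.\<close>

definition letter_diff :: "nat \<Rightarrow> (nat \<Rightarrow> nat) \<Rightarrow> nat \<Rightarrow> int" where
  "letter_diff p A i = (int (A (Suc i)) - int (A i)) mod int p"

lemma letter_diff_cong:
  assumes "A i mod p = A j mod p" "A (Suc i) mod p = A (Suc j) mod p"
  shows "letter_diff p A i = letter_diff p A j"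
  using assms unfolding letter_diff_def
  by (intro mod_diff_cong) (simp_all flip: of_nat_mod)

locale block_recurrence =
  fixes p k W :: nat and A :: "nat \<Rightarrow> nat"
  assumes prime: "prime p" and k: "2 \<le> k" and W: "W < p ^ k"
    and rec: "\<And>i. p ^ (k - 1) \<le> i \<Longrightarrow> A i = A (i div p) + of_bool (i mod p ^ k = W)"
begin

text \<open>With the last digit \<open>y\<close> of the word split off, \<open>V\<close> is the
  value of the other \<open>k - 1\<close> digits. For \<open>n \<ge> Q\<close> an occurrence ends at
  \<open>p * n + y\<close> exactly if \<open>n mod Q = V\<close>.\<close>

definition Q where "Q = p ^ (k - 1)"
definition V where "V = W div p"
definition y where "y = W mod p"

lemma p2: "2 \<le> p"
  using prime prime_ge_2_nat by blast

lemma power_k: "p ^ k = p * Q"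
  unfolding Q_def using k by (simp flip: power_Suc)

lemma Q: "p dvd Q" "p \<le> Q" "0 < Q"
proof -
  show "p dvd Q"
    using k by (cases "k - 1") (auto simp: Q_def)
  show "0 < Q"
    using p2 by (simp add: Q_def)
  with \<open>p dvd Q\<close> show "p \<le> Q"
    by (rule dvd_imp_le)
qed

lemma W_eq: "W = p * V + y" "y < p" "V < Q"
proof -
  show "W = p * V + y" "y < p"
    using p2 by (auto simp: V_def y_def)
  show "V < Q"
    using W p2 by (simp add: V_def power_k less_mult_imp_div_less mult.commute)
qed

lemma mod_eq_W_iff:
  assumes "r < p"
  shows "(p * n + r) mod p ^ k = W \<longleftrightarrow> r = y \<and> n mod Q = V"
proof -
  have "(p * n + r) mod p ^ k = p * (n mod Q) + r"
    using assms by (simp add: power_k mod_mult2_eq)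
  moreover have "p * (n mod Q) + r = p * V + y \<longleftrightarrow> r = y \<and> n mod Q = V"
  proof
    assume eq: "p * (n mod Q) + r = p * V + y"
    have "(p * (n mod Q) + r) div p = n mod Q" "(p * V + y) div p = V"
      using assms W_eq(2) by auto
    then show "r = y \<and> n mod Q = V"
      using eq by simp
  qed simp
  ultimately show ?thesis
    using W_eq(1) by simp
qed

lemma rec_digit:
  assumes "Q \<le> n" "r < p"
  shows "A (p * n + r) = A n + of_bool (r = y \<and> n mod Q = V)"
proof -
  have "n \<le> p * n"
    using p2 by simp
  then have "p ^ (k - 1) \<le> p * n + r"
    using assms(1) unfolding Q_def by linarith
  from rec [OF this] show ?thesis
    using assms(2) by (simp add: mod_eq_W_iff)
qed

section \<open>Long periods divisible by \<open>p\<close>\<close>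

text \<open>The bound \<open>Q * L \<le> s\<close> scales with the period and so survives the
  descent. It keeps every \<open>n\<close> in question at least \<open>Q\<close>, where
  \<open>rec_digit\<close> applies.\<close>

lemma no_multiple_period:
  assumes "p dvd L" "Q \<le> L" "Q * L \<le> s"
    and "\<And>i. s \<le> i \<Longrightarrow> i < s + p * L \<Longrightarrow> A (i + L) mod p = A i mod p"
  shows False
  using assms
proof (induction L arbitrary: s rule: less_induct)
  case (less L)
  note per = less.prems(4)
  obtain M where L: "L = p * M"
    using less.prems(1) by auto
  \<comment> \<open>A digit other than \<open>y\<close>, for which the recurrence adds nothing;
    \<open>s'\<close> is the least \<open>n\<close> with \<open>s \<le> p * n + r\<close>.\<close>
  define r :: nat where "r = of_bool (y = 0)"
  define s' where "s' = (s + (p - 1 - r)) div p"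
  have r: "r < p" "r \<noteq> y"
    using p2 by (auto simp: r_def)
  have "s + (p - 1 - r) = p * s' + (s + (p - 1 - r)) mod p"
    by (simp add: s'_def)
  moreover have "(s + (p - 1 - r)) mod p < p"
    using p2 by simp
  ultimately have s': "s \<le> p * s' + r" "p * s' + r < s + p"
    using r p2 by linarith+
  have "p * (Q * M) < p * Suc s'"
    using less.prems(3) s'(1) r(1) L by (simp add: algebra_simps)
  then have QM: "Q * M \<le> s'"
    by (simp only: mult_less_cancel1 less_Suc_eq_le)
  have M: "0 < M"
    using less.prems(2) L Q(3) by (cases M) auto
  then have Qs: "Q \<le> s'"
    using QM le_trans [of Q "Q * M" s'] by simp
  have perM: "A (n + M) mod p = A n mod p" if "s' \<le> n" "n < s' + p * M" for n
  proof -
    have "p * s' \<le> p * n" "p * n + p \<le> p * s' + p * L"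
      using that mult_le_mono2 [of s' n p] mult_le_mono2 [of "Suc n" "s' + L" p] L
      by (simp_all add: distrib_left)
    then have "s \<le> p * n + r" "p * n + r < s + p * L"
      using s' r by linarith+
    then have "A (p * n + r + L) mod p = A (p * n + r) mod p"
      by (rule per)
    moreover have "p * n + r + L = p * (n + M) + r"
      by (simp add: L algebra_simps)
    ultimately show ?thesis
      using that Qs r by (simp add: rec_digit)
  qed
  \<comment> \<open>Reading the period at digit \<open>y\<close> adds the indicator that is absent
    at digit \<open>r\<close>, so the indicator itself has period \<open>M\<close>. The range starts
    at \<open>s' + r\<close> because for \<open>y = 0\<close> the index \<open>p * s'\<close> may
    precede \<open>s\<close>.\<close>
  have same_class: "n mod Q = V \<longleftrightarrow> (n + M) mod Q = V"
    if n: "s' + r \<le> n" "n < s' + r + (L - 1)" for n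
  proof -
    have "Suc n < s' + r + L"
      using n(2) less.prems(2) Q(3) by linarith
    then have "p * s' + p * r \<le> p * n" "p * n + 2 * p \<le> p * s' + p * r + p * L"
      using mult_le_mono2 [OF n(1), of p] mult_le_mono2 [of "n + 2" "s' + r + L" p]
      by (simp_all add: distrib_left)
    moreover have "r = 0 \<and> 0 < y \<and> p * r = 0 \<or> r = 1 \<and> y = 0 \<and> p * r = p"
      by (auto simp: r_def)
    ultimately have "s \<le> p * n + y" "p * n + y < s + p * L"
      using s' W_eq(2) by linarith+
    then have "A (p * n + y + L) mod p = A (p * n + y) mod p"
      by (rule per)
    moreover have "p * n + y + L = p * (n + M) + y"
      by (simp add: L algebra_simps)
    ultimately have "(A (n + M) + of_bool ((n + M) mod Q = V)) mod p
        = (A n + of_bool (n mod Q = V)) mod p"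
      using n Qs W_eq(2) by (simp add: rec_digit)
    moreover have "A (n + M) mod p = A n mod p"
    proof (rule perM)
      show "n < s' + p * M"
        using n r L by (cases "y = 0") (auto simp: r_def)
    qed (use n in simp)
    ultimately show ?thesis
      using of_bool_eq_if_mod_eq [OF p2] by blast
  qed
  have "Q dvd M"
  proof (rule ccontr)
    assume "\<not> Q dvd M"
    then have neq: "(n + M) mod Q \<noteq> n mod Q" for n
      by (metis add_diff_cancel_left' le_add1 mod_eq_dvd_iff_nat)
    obtain n1 where n1: "s' + r \<le> n1" "n1 < s' + r + Q" "n1 mod Q = V"
      using ex_residue_in_interval [OF W_eq(3)] by blast
    obtain n2' where n2': "s' + r + M \<le> n2'" "n2' < s' + r + M + Q" "n2' mod Q = V"
      using ex_residue_in_interval [OF W_eq(3)] by blast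
    define n2 where "n2 = n2' - M"
    have n2: "s' + r \<le> n2" "n2 < s' + r + Q" "(n2 + M) mod Q = V"
      using n2' by (auto simp: n2_def)
    have "n1 \<noteq> n2"
      using n1 n2 neq [of n1] by auto
    \<comment> \<open>Both points lie in a window of length \<open>Q \<le> L\<close>. Being
      distinct, they cannot both be its last point, the only one that \<open>same_class\<close> may
      miss.\<close>
    then have "n1 < s' + r + (L - 1) \<or> n2 < s' + r + (L - 1)"
      using n1 n2 less.prems(2) by linarith
    then show False
      using same_class [OF n1(1)] same_class [OF n2(1)] n1(3) n2(3) neq [of n1] neq [of n2] by metis
  qed
  with M have "Q \<le> M"
    by (simp add: dvd_imp_le)
  moreover have "M < L"
    using M p2 by (simp add: L)
  moreover have "p dvd M"
    using \<open>Q dvd M\<close> Q(1) dvd_trans by blast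
  ultimately show False
    using less.IH [of M s'] QM perM by blast
qed

section \<open>Long periods prime to \<open>p\<close>\<close>

abbreviation "D \<equiv> letter_diff p A"

lemma D_inner:
  assumes "Q \<le> n" "Suc r < p"
  shows "D (p * n + r) =
    (of_bool (Suc r = y \<and> n mod Q = V) - of_bool (r = y \<and> n mod Q = V)) mod int p"
  using rec_digit [of n r] rec_digit [of n "Suc r"] assms by (simp add: letter_diff_def)

text \<open>Across a carry the counts of \<open>n\<close> and \<open>Suc n\<close> do not cancel,
  which leaves \<open>D n\<close> as a further summand.\<close>

lemma D_carry:
  assumes "Q \<le> n"
  shows "D (p * n + (p - 1)) =
    (D n + of_bool (y = 0 \<and> Suc n mod Q = V) - of_bool (y = p - 1 \<and> n mod Q = V)) mod int p"
proof -
  have "Suc (p * n + (p - 1)) = p * Suc n + 0"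
    using p2 by simp
  then have "A (Suc (p * n + (p - 1))) = A (Suc n) + of_bool (y = 0 \<and> Suc n mod Q = V)"
    using rec_digit [of "Suc n" 0] assms p2 by (simp only: eq_commute [of 0 y])
  moreover have "A (p * n + (p - 1)) = A n + of_bool (y = p - 1 \<and> n mod Q = V)"
    using rec_digit [of n "p - 1"] assms p2 by (simp only: eq_commute [of "p - 1" y])
  ultimately have "D (p * n + (p - 1)) = ((int (A (Suc n)) - int (A n))
      + (of_bool (y = 0 \<and> Suc n mod Q = V) - of_bool (y = p - 1 \<and> n mod Q = V))) mod int p"
    unfolding letter_diff_def by (simp add: algebra_simps)
  then show ?thesis
    by (simp add: letter_diff_def mod_simps algebra_simps)
qed

text \<open>As \<open>p\<close> is prime, \<open>L\<close> is invertible modulo \<open>p\<close>, so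
  the residues for different \<open>j\<close> are distinct and exhaust all \<open>p\<close>
  possibilities.\<close>

lemma ex_multiple_residue:
  assumes "\<not> p dvd L" "\<rho> < p"
  shows "\<exists>j<p. (i + j * L) mod p = \<rho>"
proof -
  let ?f = "\<lambda>j. (i + j * L) mod p"
  have eq: "j = j'" if "?f j = ?f j'" "j \<le> j'" "j' < p" for j j'
  proof -
    have "p dvd (i + j' * L) - (i + j * L)"
      using that by (subst mod_eq_dvd_iff_nat [symmetric]) auto
    then have "p dvd (j' - j) * L"
      by (simp add: diff_mult_distrib)
    then have "p dvd j' - j"
      using prime assms(1) by (simp add: prime_dvd_mult_iff)
    then show ?thesis
      using that nat_dvd_not_less [of "j' - j" p] by fastforce
  qed
  have "inj_on ?f {..<p}"
  proof (rule inj_onI)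
    fix j j' assume "j \<in> {..<p}" "j' \<in> {..<p}" "?f j = ?f j'"
    then show "j = j'"
      using eq [of j j'] eq [of j' j] by (cases "j \<le> j'") auto
  qed
  moreover have "?f ` {..<p} \<subseteq> {..<p}"
    using p2 by auto
  ultimately have "?f ` {..<p} = {..<p}"
    by (intro endo_inj_surj) auto
  then show ?thesis
    using assms(2) by (metis (no_types, lifting) imageE lessThan_iff)
qed

lemma no_coprime_period:
  assumes L: "\<not> p dvd L" "p ^ (k + 2) \<le> L" "L \<le> s"
    and per: "\<And>i. s \<le> i \<Longrightarrow> i < s + p * L \<Longrightarrow> A (i + L) mod p = A i mod p"
  shows False
proof -
  define R where "R = p * Q"
  have "p ^ (k + 2) = p * p * R"
    using power_k by (simp add: R_def power_add power2_eq_square)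
  moreover have "2 * 2 * R \<le> p * p * R"
    by (intro mult_le_mono p2 le_refl)
  moreover have "2 * Q \<le> R"
    unfolding R_def by (intro mult_le_mono p2 le_refl)
  ultimately have R: "4 * R \<le> L" "2 * Q \<le> R"
    using L(2) by linarith+
  have multi: "A (i + j * L) mod p = A i mod p" if "s \<le> i" "i < s + L" "j < p" for i j
    using that(3)
  proof (induction j)
    case (Suc j)
    have "j * L + L \<le> p * L"
      using Suc.prems mult_le_mono1 [of "Suc j" p L] by simp
    then have "A (i + j * L + L) mod p = A (i + j * L) mod p"
      using that by (intro per) auto
    then show ?case
      using Suc by (simp add: algebra_simps)
  qed simp
  \<comment> \<open>Every position can be traded for one with a prescribed last digit and the same
    \<open>D\<close>, at the price of losing control over \<open>n\<close>.\<close>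
  have shift: "\<exists>n\<ge>Q. D i = D (p * n + \<rho>)"
    if i: "s \<le> i" "Suc i < s + L" and \<rho>: "\<rho> < p" for i \<rho>
  proof -
    obtain j where j: "j < p" "(i + j * L) mod p = \<rho>"
      using ex_multiple_residue [OF L(1) \<rho>] by blast
    define n where "n = (i + j * L) div p"
    have n: "i + j * L = p * n + \<rho>"
      using j by (auto simp: n_def)
    have "p * Q \<le> i + j * L"
      using R L(3) i by (simp add: R_def)
    then have "Q \<le> n"
      using p2 by (simp add: n_def less_eq_div_iff_mult_less_eq mult.commute)
    moreover have "D i = D (i + j * L)"
      using multi [of i j] multi [of "Suc i" j] i j by (intro letter_diff_cong) auto
    ultimately show ?thesis
      using n by auto
  qed
  consider "p = 2" | "3 \<le> p"
    using p2 by linarith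
  then show False
  proof cases
    case 2
    \<comment> \<open>If \<open>y\<close> is the first or last digit, some last digit makes the
      explicit value zero. Otherwise the readings at \<open>y\<close> and \<open>y - 1\<close> put
      \<open>D i\<close> into \<open>{0, -1}\<close> and \<open>{0, 1}\<close>, which meet only in
      \<open>0\<close> modulo \<open>p \<ge> 3\<close>.\<close>
    have zero: "D i = 0" if i: "s \<le> i" "Suc i < s + L" for i
    proof -
      consider "y = 0" | "y = p - 1" | "0 < y" "Suc y < p"
        using W_eq(2) by linarith
      then show ?thesis
      proof cases
        case 1
        then show ?thesis
          using shift [OF i, of 1] 2 D_inner [of _ 1] by auto
      next
        case top: 2
        then show ?thesis
          using shift [OF i, of 0] 2 D_inner [of _ 0] by auto
      next
        case 3
        obtain n n' where n: "Q \<le> n" "D i = D (p * n + y)"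
          and n': "Q \<le> n'" "D i = D (p * n' + (y - 1))"
          using shift [OF i W_eq(2)] shift [OF i less_imp_diff_less [OF W_eq(2)]] by metis
        have "D i = (- of_bool (n mod Q = V)) mod int p"
          using n 3 by (simp add: D_inner)
        moreover have "D i = of_bool (n' mod Q = V) mod int p"
          using n' 3 D_inner [of n' "y - 1"] by simp
        moreover have "(- 1) mod int p \<noteq> 1 mod int p"
          using 2 by (simp add: zmod_minus1)
        ultimately show ?thesis
          by (auto simp: of_bool_def split: if_splits)
      qed
    qed
    \<comment> \<open>An occurrence ends at \<open>p * n + y\<close> close to \<open>s\<close>, and
      inside that block the count changes by one, against \<open>zero\<close>.\<close>
    obtain n where n: "s div p + 1 \<le> n" "n < s div p + 1 + Q" "n mod Q = V"
      using ex_residue_in_interval [OF W_eq(3)] by blast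
    have "p * (s div p) \<le> s" "s < p * (s div p) + p"
      using p2 mult_div_mod_eq [of p s] mod_less_divisor [of p s] by linarith+
    moreover have "p * (s div p) + p \<le> p * n" "p * n \<le> p * (s div p) + R"
      using mult_le_mono2 [of "s div p + 1" n p] mult_le_mono2 [of n "s div p + Q" p] n
      by (simp_all add: R_def distrib_left)
    ultimately have pn: "s \<le> p * n" "p * n \<le> s + R"
      by linarith+
    have "p \<le> R"
      using Q(2) R by linarith
    have "R \<le> p * n"
      using pn(1) L(3) R by linarith
    then have Qn: "Q \<le> n"
      using p2 by (simp add: R_def)
    show False
    proof (cases "y = p - 1")
      case True
      have "D (p * n + (p - 2)) = 1 mod int p"
      proof -
        have "Suc (p - 2) = y" "p - 2 \<noteq> y" "Suc (p - 2) < p"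
          using True 2 by linarith+
        then show ?thesis
          using D_inner [OF Qn, of "p - 2"] n(3) by simp
      qed
      moreover have "D (p * n + (p - 2)) = 0"
        using pn R \<open>p \<le> R\<close> 2 by (intro zero) linarith+
      ultimately show False
        using 2 by simp
    next
      case False
      then have "Suc y < p"
        using W_eq(2) by linarith
      then have "D (p * n + y) = (- 1) mod int p"
        using D_inner [OF Qn] n(3) by simp
      moreover have "D (p * n + y) = 0"
        using pn R \<open>p \<le> R\<close> \<open>Suc y < p\<close> 2 by (intro zero) linarith+
      ultimately show False
        using 2 by (simp add: zmod_minus1)
    qed
  next
    case 1
    \<comment> \<open>For \<open>p = 2\<close> the index \<open>4 * n + 1\<close> is compared with
      its shift by \<open>2 * Q\<close>. Both have the same carry correction \<open>e\<close>, but
      \<open>D (2 * n) = 1\<close> and \<open>D (2 * n + Q) = 0\<close>. The odd shift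
      \<open>L\<close> moves both to even indices whose halves are congruent modulo
      \<open>Q\<close>, and there \<open>D\<close> agrees.\<close>
    have D_even: "D (2 * n) = of_bool (n mod Q = V)" if "Q \<le> n" for n
      using D_inner [OF that, of 0] W_eq(2) 1 by (auto simp: less_2_cases_iff of_bool_def)
    obtain H where H: "Q = 2 * H" "0 < H"
      using Q 1 by (auto elim: dvdE)
    obtain n where n: "s div 4 + 1 \<le> n" "n < s div 4 + 1 + Q" "n mod Q = V"
      using ex_residue_in_interval [OF W_eq(3)] by blast
    define e :: int where "e = of_bool (y = 0 \<and> Suc (2 * n) mod Q = V)
      - of_bool (y = p - 1 \<and> 2 * n mod Q = V)"
    let ?i = "2 * (2 * n) + 1"
    have R_eq: "R = 2 * Q"
      using 1 by (simp add: R_def)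
    have Qn: "Q \<le> n"
      using n R R_eq L(3) by linarith
    have i: "s \<le> ?i" "Suc (?i + 2 * Q) < s + L"
      using n R R_eq Q 1 by linarith+
    have "(n + H) mod Q \<noteq> V"
    proof
      assume "(n + H) mod Q = V"
      then have "(n + H) mod Q = n mod Q"
        using n by simp
      then have "Q dvd H"
        by (metis add_diff_cancel_left' le_add1 mod_eq_dvd_iff_nat)
      then show False
        using H by (auto dest: dvd_imp_le)
    qed
    then have "D (2 * (n + H)) = 0"
      using D_even [of "n + H"] Qn by simp
    moreover have "2 * (n + H) = 2 * n + Q"
      using H by simp
    ultimately have Dn: "D (2 * n) = 1" "D (2 * n + Q) = 0"
      using D_even [of n] Qn n by simp_all
    have "D ?i = (D (2 * n) + e) mod 2"
      using D_carry [of "2 * n"] Qn 1 by (simp add: e_def algebra_simps)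
    moreover have "D (?i + 2 * Q) = (D (2 * n + Q) + e) mod 2"
    proof -
      have "?i + 2 * Q = 2 * (2 * n + Q) + 1" "Suc (2 * n + Q) mod Q = Suc (2 * n) mod Q"
        by (simp_all flip: add_Suc)
      then show ?thesis
        using D_carry [of "2 * n + Q"] Qn 1 by (simp add: e_def algebra_simps)
    qed
    moreover have "D (?i + 2 * Q) = D ?i"
    proof -
      have step: "D j = D (j + L)" if "s \<le> j" "Suc j < s + L" for j
        using multi [of j 1] multi [of "Suc j" 1] that 1 by (intro letter_diff_cong) auto
      have "odd L"
        using L(1) 1 by simp
      then obtain u where u: "?i + L = 2 * u"
        by (metis dvdE odd_add odd_one odd_two_times_div_two_succ even_mult_iff even_numeral)
      then have u': "?i + 2 * Q + L = 2 * (u + Q)"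
        by simp
      have "Q \<le> u"
        using u Qn by linarith
      then have "D (2 * u) = D (2 * (u + Q))"
        using D_even [of u] D_even [of "u + Q"] by simp
      moreover have "D ?i = D (?i + L)" "D (?i + 2 * Q) = D (?i + 2 * Q + L)"
        by (rule step; use i in linarith)+
      ultimately show ?thesis
        unfolding u u' by (simp only:)
    qed
    ultimately have "(1 + e) mod 2 = (0 + e) mod 2"
      using Dn by simp
    then show False
      by presburger
  qed
qed


section \<open>Runs of every letter, arbitrarily far out\<close>

text \<open>A multiple of \<open>Q\<close> ends in \<open>k - 1\<close> zeros, so a window of
  \<open>k\<close> digits ending in the appended part sees only these zeros and appended digits.
  Hence \<open>g\<close> does not depend on \<open>T\<close>.\<close>

lemma append_after_zeros:
  assumes "\<rho> < p ^ K"
  shows "\<exists>g. \<forall>T. Q dvd T \<longrightarrow> Q \<le> T \<longrightarrow> A (p ^ K * T + \<rho>) = A T + g"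
  using assms
proof (induction K arbitrary: \<rho>)
  case (Suc K)
  then have "\<rho> div p < p ^ K"
    by (simp add: less_mult_imp_div_less mult.commute)
  from Suc.IH [OF this] obtain g
    where g: "\<And>T. Q dvd T \<Longrightarrow> Q \<le> T \<Longrightarrow> A (p ^ K * T + \<rho> div p) = A T + g"
    by blast
  have "A (p ^ Suc K * T + \<rho>) = A T + (g + of_bool (\<rho> mod p = y \<and> \<rho> div p mod Q = V))"
    if T: "Q dvd T" "Q \<le> T" for T
  proof -
    let ?n = "p ^ K * T + \<rho> div p"
    have "1 * T \<le> p ^ K * T"
      using p2 by (intro mult_le_mono1) simp
    then have "Q \<le> ?n"
      using T by linarith
    moreover have "?n mod Q = \<rho> div p mod Q"
      using mod_mult_self3 [of "p ^ K * (T div Q)" Q "\<rho> div p"] T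
      by (simp add: mult.assoc dvd_div_mult_self)
    moreover have "p ^ Suc K * T + \<rho> = p * ?n + \<rho> mod p"
      by (simp add: distrib_left mult.assoc)
    ultimately show ?thesis
      using g [OF T] p2 by (simp add: rec_digit)
  qed
  then show ?case
    by blast
qed (intro exI [of _ 0], simp)

text \<open>If the word consists of zeros, one more zero is appended. Otherwise the word itself is
  appended, then \<open>k - 1\<close> zeros to reach a multiple of \<open>Q\<close> again.\<close>

lemma increment_after_zeros:
  assumes T: "Q dvd T" "Q \<le> T"
  shows "\<exists>T' > T. Q dvd T' \<and> A T' = Suc (A T)"
proof (cases "W = 0")
  case True
  then have "y = 0" "V = 0"
    unfolding y_def V_def by simp_all
  then have "A (p * T + 0) = Suc (A T)"
    using rec_digit [of T 0] T p2 by simp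
  moreover have "T < p * T"
    using T Q p2 by simp
  ultimately show ?thesis
    using T by (intro exI [of _ "p * T"]) auto
next
  case False
  have Tpos: "0 < T"
    using T Q by linarith
  have ge: "Q \<le> p ^ j * T + d" for j d
  proof -
    have "1 * T \<le> p ^ j * T"
      using p2 by (intro mult_le_mono1) simp
    then show ?thesis
      using T by linarith
  qed
  \<comment> \<open>\<open>X j\<close> is \<open>T\<close> followed by the first \<open>j\<close>
    digits of the word. For \<open>0 < j < k\<close> its last \<open>k\<close> digits have the value
    \<open>W div p ^ (k - j) < W\<close>, so no occurrence is completed before
    \<open>j = k\<close>.\<close>
  define X where "X j = p ^ j * T + W div p ^ (k - j)" for j
  have "A (X j) = A T + of_bool (j = k)" if "j \<le> k" for j
    using that
  proof (induction j)
    case 0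
    then show ?case
      using W k by (simp add: X_def)
  next
    case (Suc j)
    have kj: "k - j = Suc (k - Suc j)"
      using Suc.prems by simp
    have X: "X (Suc j) div p = X j"
    proof -
      have "X (Suc j) = p * (p ^ j * T) + W div p ^ (k - Suc j)"
        by (simp add: X_def)
      then have "X (Suc j) div p = p ^ j * T + W div p ^ (k - Suc j) div p"
        using p2 by simp
      moreover have "W div p ^ (k - Suc j) div p = W div p ^ (k - j)"
        unfolding kj power_Suc2 by (simp add: div_mult2_eq)
      ultimately show ?thesis
        by (simp add: X_def)
    qed
    have "p ^ k dvd p ^ Suc j * T"
      unfolding power_k power_Suc mult.assoc using T(1) by (intro mult_dvd_mono dvd_mult) auto
    then have "X (Suc j) mod p ^ k = W div p ^ (k - Suc j) mod p ^ k"
      by (auto simp: X_def elim!: dvdE)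
    also have "\<dots> = W div p ^ (k - Suc j)"
      using W div_le_dividend le_less_trans by (intro mod_less) blast
    finally have "X (Suc j) mod p ^ k = W \<longleftrightarrow> W div p ^ (k - Suc j) = W"
      by simp
    also have "\<dots> \<longleftrightarrow> Suc j = k"
    proof
      assume eq: "W div p ^ (k - Suc j) = W"
      show "Suc j = k"
      proof (rule ccontr)
        assume "Suc j \<noteq> k"
        then have "1 < p ^ (k - Suc j)"
          using Suc.prems p2 by (intro one_less_power) auto
        then have "W div p ^ (k - Suc j) < W"
          using False by (intro div_less_dividend) auto
        then show False
          using eq by simp
      qed
    qed auto
    finally have "A (X (Suc j)) = A (X j) + of_bool (Suc j = k)"
      using rec [of "X (Suc j)"] ge [of "Suc j"] X by (simp add: X_def Q_def)
    then show ?case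
      using Suc by simp
  qed
  from this [of k] have Xk: "A (X k) = Suc (A T)"
    by simp
  have "A (p ^ m * X k) = A (X k)" for m
  proof (induction m)
    case (Suc m)
    let ?q = "p ^ Suc m"
    \<comment> \<open>An occurrence ending in the added zeros would give
      \<open>p ^ k dvd (?q - 1) * W\<close>. As \<open>?q - 1\<close> is prime to \<open>p\<close>,
      this contradicts \<open>0 < W < p ^ k\<close>.\<close>
    have "?q * X k mod p ^ k \<noteq> W"
    proof
      assume "?q * X k mod p ^ k = W"
      moreover have "?q * X k = ?q * W + p ^ k * (?q * T)"
        by (simp add: X_def algebra_simps)
      ultimately have "?q * W mod p ^ k = W mod p ^ k"
        using W by (simp only: mod_mult_self2 mod_less)
      then have "p ^ k dvd ?q * W - W"
        using p2 by (subst mod_eq_dvd_iff_nat [symmetric]) auto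
      then have dvd: "p ^ k dvd (?q - 1) * W"
        by (simp add: diff_mult_distrib)
      have "coprime (?q - 1) ?q"
        using p2 by (intro coprime_diff_one_left_nat) simp
      then have "coprime (p ^ k) (?q - 1)"
        by (simp add: coprime_commute)
      with dvd have "p ^ k dvd W"
        by (simp add: coprime_dvd_mult_right_iff)
      then show False
        using W False by (simp add: nat_dvd_not_less)
    qed
    moreover have "Q \<le> ?q * X k"
    proof -
      have "?q * X k = p ^ (Suc m + k) * T + ?q * W"
        by (simp add: X_def power_add algebra_simps)
      then show ?thesis
        by (simp only: ge)
    qed
    moreover have "?q * X k div p = p ^ m * X k"
      using p2 by (simp add: mult.assoc)
    ultimately have "A (?q * X k) = A (p ^ m * X k)"
      using rec [of "?q * X k"] by (simp add: Q_def)
    then show ?case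
      using Suc by simp
  qed simp
  from this [of "k - 1"] have "A (Q * X k) = Suc (A T)"
    using Xk by (simp add: Q_def)
  moreover have "T < Q * X k"
  proof -
    have "1 * T < p ^ k * T"
      using Tpos k p2 by (intro mult_strict_right_mono one_less_power) auto
    moreover have "1 * X k \<le> Q * X k"
      using Q by (intro mult_le_mono1) simp
    moreover have "p ^ k * T \<le> X k"
      by (simp add: X_def)
    ultimately show ?thesis
      by linarith
  qed
  ultimately show ?thesis
    by (intro exI [of _ "Q * X k"]) auto
qed

lemma ex_letter_in_class:
  assumes "\<rho> < p ^ K" "c < p"
  shows "\<exists>l\<ge>N. l mod p ^ K = \<rho> \<and> A l mod p = c"
proof -
  obtain g where g: "\<And>T. Q dvd T \<Longrightarrow> Q \<le> T \<Longrightarrow> A (p ^ K * T + \<rho>) = A T + g"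
    using append_after_zeros [OF assms(1)] by blast
  define T0 where "T0 = Q * Suc N"
  have "\<exists>T \<ge> T0. Q dvd T \<and> A T = A T0 + j" for j
  proof (induction j)
    case 0
    then show ?case
      by (intro exI [of _ T0]) (simp add: T0_def)
  next
    case (Suc j)
    then obtain T where T: "T0 \<le> T" "Q dvd T" "A T = A T0 + j"
      by blast
    moreover have "Q \<le> T"
      using T(1) by (simp add: T0_def)
    ultimately obtain T' where "T < T'" "Q dvd T'" "A T' = Suc (A T)"
      using increment_after_zeros by blast
    then show ?case
      using T by (intro exI [of _ T']) auto
  qed
  \<comment> \<open>This many increments raise the final count to \<open>c + p * (A T0 + g)\<close>,
    which is \<open>c\<close> modulo \<open>p\<close>.\<close>
  from this [of "c + (p - 1) * (A T0 + g)"] obtain T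
    where T: "T0 \<le> T" "Q dvd T" "A T = A T0 + (c + (p - 1) * (A T0 + g))"
    by blast
  have QT: "Q \<le> T"
    using T(1) by (simp add: T0_def)
  have "1 * Suc N \<le> Q * Suc N"
    using Q by (intro mult_le_mono1) simp
  then have NT: "N \<le> T"
    using T(1) by (simp add: T0_def)
  have "1 * T \<le> p ^ K * T"
    using p2 by (intro mult_le_mono1) simp
  then have "N \<le> p ^ K * T + \<rho>"
    using NT by linarith
  moreover have "A (p ^ K * T + \<rho>) = c + p * (A T0 + g)"
  proof -
    have "(p - 1) * (A T0 + g) + (A T0 + g) = p * (A T0 + g)"
      using p2 by (cases p) auto
    then show ?thesis
      using g [OF T(2) QT] T(3) by linarith
  qed
  ultimately show ?thesis
    using assms by (intro exI [of _ "p ^ K * T + \<rho>"]) simp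
qed

lemma ex_letter: "c < p \<Longrightarrow> \<exists>l\<ge>N. A l mod p = c"
  using ex_letter_in_class [of 0 0 c N] by auto

text \<open>A first appended digit gives neighbours \<open>m\<close> and \<open>Suc m\<close> with
  the count of \<open>l\<close>. A second one gives a whole block of \<open>p\<close> equal counts
  and one adjacent index: the block of \<open>m\<close> if \<open>y \<noteq> 0\<close>, that of
  \<open>Suc m\<close> if \<open>y = 0\<close>. The extra index then has a last digit other than
  \<open>y\<close>.\<close>

lemma run_at:
  assumes "Q \<le> l" "l mod Q \<noteq> V" "Suc r < p"
    and "y \<noteq> 0 \<Longrightarrow> (p * l + r) mod Q \<noteq> V" "y = 0 \<Longrightarrow> Suc (p * l + r) mod Q \<noteq> V"
  shows "\<exists>q\<ge>l. \<forall>j\<le>p. A (q + j) = A l"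
proof -
  define m where "m = p * l + r"
  have "l \<le> p * l"
    using p2 by simp
  then have lm: "l \<le> m" "Q \<le> m"
    using assms(1) unfolding m_def by linarith+
  have m: "A m = A l" "A (Suc m) = A l"
    using rec_digit [OF assms(1), of r] rec_digit [OF assms(1), of "Suc r"] assms(2,3)
    by (simp_all add: m_def)
  have "m \<le> p * m"
    using p2 by simp
  show ?thesis
  proof (cases "y = 0")
    case False
    have "A (p * m + j) = A l" if "j \<le> p" for j
    proof (cases "j = p")
      case True
      then have "p * m + j = p * Suc m + 0"
        by simp
      then show ?thesis
        using rec_digit [of "Suc m" 0] lm m False p2 by (simp only:) simp
    next
      case False
      then show ?thesis
        using rec_digit [of m j] lm m that \<open>y \<noteq> 0\<close> assms(4) by (simp add: m_def)
    qed
    then show ?thesis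
      using le_trans [OF lm(1) \<open>m \<le> p * m\<close>] by (intro exI [of _ "p * m"]) blast
  next
    case True
    have "A (p * m + (p - 1) + j) = A l" if "j \<le> p" for j
    proof (cases j)
      case 0
      then show ?thesis
        using rec_digit [of m "p - 1"] lm m True p2 by simp
    next
      case (Suc i)
      then have "p * m + (p - 1) + j = p * Suc m + i"
        using p2 by simp
      then show ?thesis
        using rec_digit [of "Suc m" i] lm m True that Suc assms(5) by (simp only:) (simp add: m_def)
    qed
    then show ?thesis
      using trans_le_add1 [OF le_trans [OF lm(1) \<open>m \<le> p * m\<close>]]
      by (intro exI [of _ "p * m + (p - 1)"]) blast
  qed
qed

lemma ex_run:
  assumes "c < p"
  shows "\<exists>q\<ge>N. \<forall>j\<le>p. A (q + j) mod p = c"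
proof -
  have generic: ?thesis if hyps: "\<rho> < Q" "\<rho> \<noteq> V" "Suc r < p"
    "y \<noteq> 0 \<Longrightarrow> (p * \<rho> + r) mod Q \<noteq> V" "y = 0 \<Longrightarrow> Suc (p * \<rho> + r) mod Q \<noteq> V" for \<rho> r
  proof -
    obtain l where l: "N + Q \<le> l" "l mod Q = \<rho>" "A l mod p = c"
      using ex_letter_in_class [OF hyps(1) [unfolded Q_def] assms, of "N + Q"]
      unfolding Q_def [symmetric] by blast
    have "(p * l + t) mod Q = (p * \<rho> + t) mod Q" for t
      unfolding l(2) [symmetric] by (metis mod_add_left_eq mod_mult_right_eq)
    from this [of r] this [of "Suc r"]
    have "(p * l + r) mod Q = (p * \<rho> + r) mod Q" "Suc (p * l + r) mod Q = Suc (p * \<rho> + r) mod Q"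
      by simp_all
    then obtain q where "l \<le> q" "\<forall>j\<le>p. A (q + j) = A l"
      using run_at [of l r] hyps l by auto
    then show ?thesis
      using l by (intro exI [of _ q]) auto
  qed
  consider "3 \<le> p" | "p = 2" "4 dvd Q" | "p = 2" "Q = 2"
  proof -
    have "k - 1 = 1 \<or> (\<exists>t. k - 1 = Suc (Suc t))"
      using k by presburger
    then have "p = 2 \<longrightarrow> 4 dvd Q \<or> Q = 2"
      unfolding Q_def by auto
    then show ?thesis
      using p2 that by linarith
  qed
  then show ?thesis
  proof cases
    case 1
    define \<rho> :: nat where "\<rho> = of_bool (V = 0)"
    have \<rho>: "\<rho> < Q" "\<rho> \<noteq> V"
      using Q p2 by (auto simp: \<rho>_def)
    have neq: "Suc x mod Q \<noteq> x mod Q" for x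
      using Q p2 by (simp add: mod_Suc)
    \<comment> \<open>Passing from \<open>r = 0\<close> to \<open>r = 1\<close> moves
      \<open>x\<close> by one, so at most one choice hits \<open>V\<close> modulo \<open>Q\<close>.
      Both are allowed since \<open>p \<ge> 3\<close>.\<close>
    define x where "x = p * \<rho> + of_bool (y = 0)"
    show ?thesis
    proof (cases "x mod Q = V")
      case True
      then show ?thesis
        by (intro generic [OF \<rho>, of 1]) (use 1 neq [of x] in \<open>auto simp: x_def\<close>)
    next
      case False
      then show ?thesis
        by (intro generic [OF \<rho>, of 0]) (use 1 in \<open>auto simp: x_def\<close>)
    qed
  next
    case 2
    then obtain h where h: "Q = 4 * h" "0 < h"
      using Q by (auto elim!: dvdE)
    consider "V = 0" | "V = 1" "y = 0" | "V \<noteq> 0" "y = 0 \<longrightarrow> V \<noteq> 1"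
      by metis
    then show ?thesis
    proof cases
      case V: 1
      show ?thesis
        by (rule generic [of 1 0]) (use V 2(1) h in \<open>auto simp: numeral_3_eq_3\<close>)
    next
      case V: 2
      have "7 mod (4 * h) \<noteq> 1"
        using h(2) by (cases "h = 1") auto
      then show ?thesis
        by (intro generic [of 3 0]) (use V 2(1) h in auto)
    next
      case V: 3
      show ?thesis
        by (rule generic [of 0 0]) (use V 2(1) h in auto)
    qed
  next
    case 3
    \<comment> \<open>For binary words of length two \<open>generic\<close> covers \<open>00\<close>
      and \<open>11\<close>. For \<open>01\<close> and \<open>10\<close> three indices among
      \<open>4 * n\<close> to \<open>4 * n + 3\<close> have count \<open>A n + 1\<close>, which is
      why \<open>n\<close> is given the other letter \<open>1 - c\<close>.\<close>
    have VY: "V < 2" "y < 2"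
      using W_eq 3 by auto
    have "\<exists>l\<ge>N + 2. l mod p ^ 1 = V \<and> A l mod p = 1 - c"
      by (rule ex_letter_in_class) (use VY 3 in auto)
    then obtain n where n: "N + 2 \<le> n" "n mod 2 = V" "A n mod 2 = 1 - c"
      using 3(1) by auto
    have step: "A (2 * i + r) = A i + of_bool (r = y \<and> i mod 2 = V)" if "2 \<le> i" "r < 2" for i r
      using rec_digit [of i r] that 3 by simp
    have A4: "A (4 * n + r) = A n + of_bool (r div 2 = y)
        + of_bool (r mod 2 = y \<and> (r div 2) mod 2 = V)" if "r < 4" for r
    proof -
      have "4 * n + r = 2 * (2 * n + r div 2) + r mod 2"
        by simp
      then have "A (4 * n + r) = A (2 * n + r div 2)
          + of_bool (r mod 2 = y \<and> (2 * n + r div 2) mod 2 = V)"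
        by (simp only:) (rule step; use n in simp)
      moreover have "A (2 * n + r div 2) = A n + of_bool (r div 2 = y)"
        using step [of n "r div 2"] n that by simp
      ultimately show ?thesis
        by simp
    qed
    have A4': "A (4 * n) = A n + of_bool (0 = y) + of_bool (0 = y \<and> 0 = V)"
      "A (4 * n + 1) = A n + of_bool (0 = y) + of_bool (1 = y \<and> 0 = V)"
      "A (4 * n + 2) = A n + of_bool (1 = y) + of_bool (0 = y \<and> 1 = V)"
      "A (4 * n + 3) = A n + of_bool (1 = y) + of_bool (1 = y \<and> 1 = V)"
      using A4 [of 0] A4 [of 1] A4 [of 2] A4 [of 3] by simp_all
    have c: "Suc (A n) mod 2 = c"
      using n(3) assms 3 by (cases "c = 0") (auto simp: mod_Suc)
    consider "V = 0" "y = 0" | "V = 1" "y = 1" | "V = 0" "y = 1" | "V = 1" "y = 0"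
      using VY by (metis One_nat_def less_2_cases)
    then show ?thesis
    proof cases
      case V: 1
      show ?thesis
        by (rule generic [of 1 0]) (use V 3 in auto)
    next
      case V: 2
      show ?thesis
        by (rule generic [of 0 0]) (use V 3 in auto)
    next
      case V: 3
      have "A (4 * n + 1 + j) mod p = c" if "j \<le> p" for j
      proof -
        have "j = 0 \<or> j = 1 \<or> j = 2"
          using that 3 by auto
        then show ?thesis
          using A4' V c 3 by (auto simp: numeral_3_eq_3)
      qed
      then show ?thesis
        using n by (intro exI [of _ "4 * n + 1"]) auto
    next
      case V: 4
      have "A (4 * n + j) mod p = c" if "j \<le> p" for j
      proof -
        have "j = 0 \<or> j = 1 \<or> j = 2"
          using that 3 by auto
        then show ?thesis
          using A4' V c 3 by auto
      qed
      then show ?thesis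
        using n by (intro exI [of _ "4 * n"]) auto
    qed
  qed
qed


lemma no_growing_block_map:
  assumes f: "block_map (\<lambda>n. A n mod p) f"
    and fixed: "\<And>i. i \<le> n \<Longrightarrow> f i = i" and grow: "Suc n < f (Suc n)"
  shows False
proof -
  define a where "a = (\<lambda>n. A n mod p)"
  \<comment> \<open>The exponent makes \<open>L\<close> at least \<open>p ^ (k + 2)\<close>, as
    \<open>no_coprime_period\<close> requires.\<close>
  define g where "g = f ^^ (p ^ (k + 2))"
  define L where "L = g (Suc n) - g n"
  have g: "block_map a g"
    unfolding a_def g_def using f by (rule block_map_funpow)
  have "g n = n"
    unfolding g_def using fixed by (simp add: funpow_fixed)
  moreover have "Suc n + p ^ (k + 2) \<le> g (Suc n)"
    unfolding g_def using block_map_strict_mono [OF f] grow by (rule funpow_growth)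
  ultimately have L: "p ^ (k + 2) \<le> L"
    by (simp add: L_def)
  have an: "a n < p"
    using p2 by (simp add: a_def)
  have "\<exists>N. j \<le> card {i. i < N \<and> a i = a n}" for j
  proof (induction j)
    case (Suc j)
    then obtain N where N: "j \<le> card {i. i < N \<and> a i = a n}"
      by blast
    obtain l where l: "N \<le> l" "a l = a n"
      using ex_letter [OF an] by (auto simp: a_def)
    have "card (insert l {i. i < N \<and> a i = a n}) \<le> card {i. i < Suc l \<and> a i = a n}"
      using l by (intro card_mono) auto
    moreover have "card (insert l {i. i < N \<and> a i = a n}) = Suc (card {i. i < N \<and> a i = a n})"
      using l by simp
    ultimately show ?case
      using N by (intro exI [of _ "Suc l"]) linarith
  qed simp
  \<comment> \<open>\<open>Q\<close> occurrences of the letter before the run yield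
    \<open>Q * L \<le> g q\<close>, as \<open>no_multiple_period\<close> requires.\<close>
  then obtain N where N: "Q \<le> card {i. i < N \<and> a i = a n}"
    by blast
  obtain q where q: "N \<le> q" "\<And>j. j \<le> p \<Longrightarrow> a (q + j) = a n"
    using ex_run [OF an, of N] by (auto simp: a_def)
  have "card {i. i < N \<and> a i = a n} \<le> card {i. i < q \<and> a i = a n}"
    using q(1) by (intro card_mono) auto
  then have "Q * L \<le> card {i. i < q \<and> a i = a n} * L"
    using N by (intro mult_le_mono1) linarith
  also have "\<dots> \<le> g q"
    unfolding L_def by (rule block_map_count_le [OF g])
  finally have QL: "Q * L \<le> g q" .
  have gq: "g (q + j) = g q + j * L" if "j \<le> Suc p" for j
    unfolding L_def using q that by (intro block_map_run [OF g]) auto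
  have "a (i + 1) = a i" if "q \<le> i" "i < q + p" for i
    using q(2) [of "i - q"] q(2) [of "i + 1 - q"] that by simp
  from block_map_period(2) [OF g this]
  have "a (i + (g (q + 1) - g q)) = a i" if "g q \<le> i" "i < g (q + p)" for i
    using that by blast
  then have per: "A (i + L) mod p = A i mod p" if "g q \<le> i" "i < g q + p * L" for i
    using that gq [of 1] gq [of p] p2 by (simp add: a_def)
  have "1 * L \<le> Q * L"
    using Q by (intro mult_le_mono1) simp
  then have Lq: "L \<le> g q"
    using QL by linarith
  have "Q \<le> p ^ (k + 2)"
    unfolding Q_def using p2 by (intro power_increasing) auto
  then have "Q \<le> L"
    using L by linarith
  show False
  proof (cases "p dvd L")
    case True
    then show False
      using no_multiple_period [OF _ \<open>Q \<le> L\<close> QL per] by blast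
  next
    case False
    then show False
      using no_coprime_period [OF _ L Lq per] by blast
  qed
qed

end

section \<open>The word 0\<close>

text \<open>The convention \<open>A 0 = 1\<close> makes the count drop by one after every multiple
  of \<open>p\<close>, including \<open>0\<close>.\<close>

locale zero_count =
  fixes p :: nat and A :: "nat \<Rightarrow> nat"
  assumes p2: "2 \<le> p" and A_0: "A 0 = 1" and A_digit: "\<And>r. 0 < r \<Longrightarrow> r < p \<Longrightarrow> A r = 0"
    and rec: "\<And>i. p \<le> i \<Longrightarrow> A i = A (i div p) + of_bool (i mod p = 0)"
begin

abbreviation "D \<equiv> letter_diff p A"

lemma rec_digit:
  assumes "0 < n" "r < p"
  shows "A (p * n + r) = A n + of_bool (r = 0)"
proof -
  have "p * 1 \<le> p * n"
    using assms by (intro mult_le_mono2) simp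
  then have "p \<le> p * n + r"
    by linarith
  from rec [OF this] show ?thesis
    using assms by simp
qed

lemma A_Suc_multiple: "A (Suc (p * n)) + 1 = A (p * n)"
  using rec_digit [of n 0] rec_digit [of n 1] A_0 A_digit [of 1] p2 by (cases "n = 0") auto

lemma D_multiple: "p dvd i \<Longrightarrow> D i = (- 1) mod int p"
proof (elim dvdE)
  fix n
  assume "i = p * n"
  moreover have "int (A (Suc (p * n))) - int (A (p * n)) = - 1"
    using A_Suc_multiple [of n] by linarith
  ultimately show ?thesis
    by (simp add: letter_diff_def)
qed

lemma minus_one_mod_neq_0: "(- 1) mod int p \<noteq> 0"
  using p2 by (simp add: zmod_minus1)

lemma D_inner:
  assumes "0 < i mod p" "Suc (i mod p) < p"
  shows "D i = 0"
proof -
  define n r where "n = i div p" and "r = i mod p"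
  have "i = p * n + r"
    by (simp add: n_def r_def)
  moreover have "A (p * n + Suc r) = A (p * n + r)"
    using rec_digit [of n r] rec_digit [of n "Suc r"] A_digit [of r] A_digit [of "Suc r"] assms
    by (cases "n = 0") (auto simp: r_def)
  ultimately show ?thesis
    by (simp add: letter_diff_def)
qed

lemma D_period:
  assumes "\<And>i. s \<le> i \<Longrightarrow> i < e \<Longrightarrow> A (i + L) mod p = A i mod p" "s \<le> i" "Suc i < e"
  shows "D (i + L) = D i"
  using assms(1) [of i] assms(1) [of "Suc i"] assms(2,3) by (intro letter_diff_cong) auto

section \<open>Impossible periods near the beginning\<close>

text \<open>The shift takes an index inside a block, where \<open>D\<close> is \<open>0\<close>, to
  a multiple of \<open>p\<close>, where it is \<open>-1\<close>. If \<open>M mod p = 1\<close>, that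
  index would be the last of its block, outside \<open>D_inner\<close>; then \<open>p\<close> is
  shifted into the interior of a block instead.\<close>

lemma no_coprime_prefix_period:
  assumes p: "3 \<le> p" and "\<not> p dvd M" and e: "p \<le> e" "M mod p = 1 \<Longrightarrow> p + 2 \<le> e"
    and per: "\<And>i. 1 \<le> i \<Longrightarrow> i < e \<Longrightarrow> A (i + M) mod p = A i mod p"
  shows False
proof (cases "M mod p = 1")
  case True
  have "D (p + M) = D p"
    using True e p by (intro D_period [OF per]) auto
  moreover have "(p + M) mod p = 1"
    using True by simp
  then have "D (p + M) = 0"
    using p by (intro D_inner) auto
  ultimately show False
    using D_multiple [of p] minus_one_mod_neq_0 by simp
next
  case False
  define i where "i = p - M mod p"
  have "M mod p \<noteq> 0"
    using assms(2) by (simp add: dvd_eq_mod_eq_0)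
  moreover have "M mod p < p"
    using p by simp
  ultimately have i: "0 < i" "Suc i < p" "i + M mod p = p"
    using False by (auto simp: i_def)
  have "D (i + M) = D i"
    using i e by (intro D_period [OF per]) auto
  moreover have "p dvd i + M"
    using i(3) by (metis dvd_eq_mod_eq_0 mod_add_right_eq mod_self)
  moreover have "D i = 0"
    using i by (intro D_inner) auto
  ultimately show False
    using D_multiple minus_one_mod_neq_0 by simp
qed

text \<open>The numbers \<open>1\<close> and \<open>p\<close> have no zero and one zero. After
  adding \<open>L\<close> they are \<open>m\<close> followed by \<open>01\<close> and by
  \<open>10\<close>, so their counts become equal.\<close>

lemma no_square_period:
  assumes "p * p dvd L" "0 < L"
    "A (1 + L) mod p = A 1 mod p" "A (p + L) mod p = A p mod p"
  shows False
proof -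
  from assms(1) obtain m where "L = p * p * m" ..
  then have L: "L = p * (p * m)"
    by (simp only: mult.assoc)
  then have m: "0 < m"
    using assms(2) by (cases m) auto
  have 1: "A (1 + L) = A m + 1" "A (p + L) = A m + 1"
  proof -
    have "1 + L = p * (p * m) + 1" "p + L = p * (p * m + 1) + 0"
      by (simp_all add: L distrib_left)
    then show "A (1 + L) = A m + 1" "A (p + L) = A m + 1"
      using rec_digit [of "p * m" 1] rec_digit [of "p * m + 1" 0] rec_digit [of m 0]
        rec_digit [of m 1] m p2 by simp_all
  qed
  have "A 1 = 0" "A p = 1"
    using A_digit [of 1] rec_digit [of 1 0] p2 by simp_all
  then show False
    using 1 assms(3,4) p2 by simp
qed

text \<open>The digit \<open>1\<close> adds no zero, so a period divisible by \<open>p\<close>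
  passes to \<open>L div p\<close> and \<open>d\<close> drops by one. For \<open>d > 0\<close> any
  other period fails at \<open>p ^ d\<close>, a multiple of \<open>p\<close>, or at the next index.
  For \<open>d = 0\<close> the two preceding lemmas apply.\<close>

lemma no_long_period:
  assumes p: "3 \<le> p" and "p ^ Suc d < L"
    and "\<And>i. p ^ d \<le> i \<Longrightarrow> i < p ^ Suc d + (p - 2) * L \<Longrightarrow> A (i + L) mod p = A i mod p"
  shows False
  using assms(2,3)
proof (induction d arbitrary: L)
  case 0
  then have L: "p < L" and per: "\<And>i. 1 \<le> i \<Longrightarrow> i < p + (p - 2) * L \<Longrightarrow> A (i + L) mod p = A i mod p"
    by simp_all
  have L1: "1 * L \<le> (p - 2) * L"
    using p by (intro mult_le_mono1) linarith
  show False
  proof (cases "p dvd L")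
    case False
    show False
      by (rule no_coprime_prefix_period [where e = "p + (p - 2) * L", OF p False _ _ per]) (use L1 L p in linarith)+
  next
    case True
    then obtain M where M: "L = p * M"
      by auto
    have M2: "2 \<le> M"
      using L M by (cases M) (auto simp: numeral_2_eq_2 Suc_le_eq)
    show False
    proof (cases "p dvd M")
      case True
      show False
      proof (rule no_square_period)
        show "p * p dvd L"
          using True M by (simp add: mult_dvd_mono)
        show "A (1 + L) mod p = A 1 mod p" "A (p + L) mod p = A p mod p"
          using per [of 1] per [of p] L L1 p by (simp_all add: add.commute)
      qed (use L in simp)
    next
      case False
      have perM: "A (n + M) mod p = A n mod p" if n: "1 \<le> n" "n < 1 + (p - 2) * M" for n
      proof -
        have "p * n \<le> p * ((p - 2) * M)"
          using n by (intro mult_le_mono2) simp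
        then have "p * n \<le> (p - 2) * L"
          by (simp add: M mult.left_commute)
        then have "A (p * n + 1 + L) mod p = A (p * n + 1) mod p"
          using p by (intro per) auto
        moreover have "p * n + 1 + L = p * (n + M) + 1"
          by (simp add: M distrib_left)
        ultimately show ?thesis
          using rec_digit [of n 1] rec_digit [of "n + M" 1] n p by simp
      qed
      have "(p - 2) * 2 \<le> (p - 2) * M" "1 * M \<le> (p - 2) * M"
        using M2 p by (intro mult_le_mono le_refl; simp)+
      moreover have "p + 1 \<le> M" if "M mod p = 1"
      proof -
        have "\<not> M < p" "M \<noteq> p"
          using that M2 by auto
        then show ?thesis
          by linarith
      qed
      ultimately show False
        by (intro no_coprime_prefix_period [where e = "1 + (p - 2) * M", OF p False _ _ perM]) (use p in linarith)+
    qed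
  qed
next
  case (Suc d)
  note L = Suc.prems(1) and per = Suc.prems(2)
  let ?s = "p ^ Suc d"
  have s: "p \<le> ?s" "3 * ?s \<le> p ^ Suc (Suc d)" "p dvd ?s"
    using p by auto
  show False
  proof (cases "p dvd L")
    case True
    then obtain M where M: "L = p * M"
      by auto
    have "p ^ Suc d < M"
      using L p by (simp add: M)
    moreover have "A (n + M) mod p = A n mod p"
      if n: "p ^ d \<le> n" "n < p ^ Suc d + (p - 2) * M" for n
    proof -
      have "p * Suc n \<le> p * (p ^ Suc d + (p - 2) * M)" "p * p ^ d \<le> p * n"
        using n by (intro mult_le_mono2; simp)+
      then have "p * n + p \<le> p ^ Suc (Suc d) + (p - 2) * L" "p ^ Suc d \<le> p * n"
        by (simp_all add: M distrib_left mult.left_commute add.commute)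
      then have "A (p * n + 1 + L) mod p = A (p * n + 1) mod p"
        using p by (intro per) linarith+
      moreover have "p * n + 1 + L = p * (n + M) + 1"
        by (simp add: M distrib_left)
      moreover have "0 < n"
        using n(1) p by (cases n) auto
      ultimately show ?thesis
        using rec_digit [of n 1] rec_digit [of "n + M" 1] p by simp
    qed
    ultimately show False
      by (rule Suc.IH)
  next
    case False
    have D0: "D (?s + L) = D ?s"
      by (rule D_period [OF per]) (assumption | use s p in linarith)+
    have D1: "D (Suc ?s + L) = D (Suc ?s)"
      by (rule D_period [OF per]) (assumption | use s p in linarith)+
    have Ds: "D ?s \<noteq> 0"
      using D_multiple [OF s(3)] minus_one_mod_neq_0 by simp
    have s_mod: "(?s + L) mod p = L mod p" "Suc ?s mod p = 1"
      using p by (auto simp: mod_Suc)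
    show False
    proof (cases "Suc (L mod p) < p")
      case True
      moreover have "0 < L mod p"
        using False by (simp add: dvd_eq_mod_eq_0)
      ultimately have "D (?s + L) = 0"
        using s_mod by (intro D_inner) simp_all
      then show False
        using D0 Ds by simp
    next
      case False
      then have "Suc (L mod p) = p"
        using p mod_less_divisor [of p L] by linarith
      then have "p dvd Suc ?s + L"
        using s_mod p by (simp add: dvd_eq_mod_eq_0 mod_Suc)
      moreover have "D (Suc ?s) = 0"
        using s_mod p by (intro D_inner) auto
      ultimately show False
        using D1 D_multiple minus_one_mod_neq_0 by simp
    qed
  qed
qed

text \<open>For a suitable \<open>i\<close> among \<open>2\<close> and \<open>4\<close>,
  \<open>i + M = 2 * n + 1\<close> with \<open>n\<close> even. Then \<open>D i = 1\<close>, whereas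
  the carry at \<open>2 * n + 1\<close> gives \<open>D n + 1\<close>, which is \<open>0\<close>
  modulo \<open>2\<close>.\<close>

lemma no_odd_period_binary:
  assumes p: "p = 2" and M: "odd M" "7 \<le> M"
    and per: "\<And>i. 1 \<le> i \<Longrightarrow> i < M \<Longrightarrow> A (i + M) mod p = A i mod p"
  shows False
proof -
  obtain i n where i: "even i" "2 \<le> i" "i \<le> 4" "i + M = 2 * n + 1" "even n"
  proof -
    have "M mod 4 = 1 \<or> M mod 4 = 3"
      using M(1) by presburger
    then show ?thesis
    proof
      assume "M mod 4 = 1"
      then have "4 + M = 2 * ((M + 3) div 2) + 1" "even ((M + 3) div 2)"
        by presburger+
      then show ?thesis
        using that [of 4 "(M + 3) div 2"] by simp
    next
      assume "M mod 4 = 3"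
      then have "2 + M = 2 * ((M + 1) div 2) + 1" "even ((M + 1) div 2)"
        by presburger+
      then show ?thesis
        using that [of 2 "(M + 1) div 2"] by simp
    qed
  qed
  have n: "0 < n"
    using i M by linarith
  have "D (i + M) = D i"
    using i M by (intro D_period [OF per]) auto
  also have "\<dots> = 1"
    using D_multiple [of i] i p by simp
  finally have "D (2 * n + 1) = 1"
    using i by simp
  moreover have "D n = 1"
    using D_multiple [of n] i p by simp
  moreover have "D (2 * n + 1) = (D n + 1) mod 2"
  proof -
    have "A (Suc (2 * n + 1)) = A (Suc n) + 1" "A (2 * n + 1) = A n"
      using rec_digit [of "Suc n" 0] rec_digit [of n 1] n p by simp_all
    then have "D (2 * n + 1) = (int (A (Suc n)) - int (A n) + 1) mod 2"
      using p by (simp add: letter_diff_def algebra_simps)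
    then show ?thesis
      using p by (simp add: letter_diff_def mod_simps)
  qed
  ultimately show False
    by simp
qed

text \<open>The bound \<open>14\<close> leaves at least \<open>7\<close> for
  \<open>no_odd_period_binary\<close> when \<open>L\<close> is twice an odd number.\<close>

lemma no_prefix_period_binary:
  assumes p: "p = 2" and L: "14 \<le> L"
    and per: "\<And>i. i < L \<Longrightarrow> A (i + L) mod p = A i mod p"
  shows False
proof (cases "odd L")
  case True
  then show False
    using no_odd_period_binary [OF p True _ per] L by simp
next
  case False
  then obtain M where M: "L = 2 * M"
    by auto
  have perM: "A (n + M) mod p = A n mod p" if "1 \<le> n" "n < M" for n
  proof -
    have "A (2 * n + 1 + L) mod p = A (2 * n + 1) mod p"
      using that M by (intro per) simp
    moreover have "2 * n + 1 + L = 2 * (n + M) + 1"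
      by (simp add: M)
    ultimately show ?thesis
      using rec_digit [of n 1] rec_digit [of "n + M" 1] that p by simp
  qed
  show False
  proof (cases "odd M")
    case True
    then show False
      using no_odd_period_binary [OF p True _ perM] L M by simp
  next
    case False
    then have "p * p dvd L"
      using M p by (auto elim!: dvdE)
    then show False
      using no_square_period [of L] per [of 1] per [of p] L p by (simp add: add.commute)
  qed
qed

section \<open>Zero digits and powers of \<open>p\<close>\<close>

lemma power_count_le: "0 < n \<Longrightarrow> p ^ A n \<le> n"
proof (induction n rule: less_induct)
  case (less n)
  show ?case
  proof (cases "n < p")
    case True
    then show ?thesis
      using A_digit less.prems by simp
  next
    case False
    define m where "m = n div p"
    have m: "0 < m" "m < n" "p * m + n mod p = n"
      using False p2 less.prems by (auto simp: m_def div_greater_zero_iff)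
    have "A n = A m + of_bool (n mod p = 0)"
      using rec [of n] False by (simp add: m_def)
    then have "p ^ A n \<le> p * p ^ A m"
      using p2 by simp
    also have "\<dots> \<le> p * m"
      using less.IH [OF m(2,1)] by simp
    also have "\<dots> \<le> n"
      using m(3) by linarith
    finally show ?thesis .
  qed
qed

lemma A_power: "A (p ^ Suc c) = Suc c"
proof (induction c)
  case 0
  then show ?case
    using rec_digit [of 1 0] A_digit [of 1] p2 by simp
next
  case (Suc c)
  then show ?case
    using rec_digit [of "p ^ Suc c" 0] p2 by simp
qed

text \<open>The upper bound excludes a carry at position \<open>c + 1\<close>. This position either
  holds the leading digit, which grows, or lies directly in front of the \<open>c + 1\<close> digits
  of \<open>i\<close> and receives a \<open>1\<close>. Either way the zeros stay the same.\<close>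

lemma A_add_power:
  assumes "p ^ c \<le> i" "i < (p - 1) * p ^ Suc c"
  shows "A (i + p ^ Suc c) = A i"
  using assms
proof (induction c arbitrary: i)
  case 0
  define n r where "n = i div p" and "r = i mod p"
  have i: "i = p * n + r" and r: "r < p"
    using p2 by (simp_all add: n_def r_def)
  have n: "Suc n < p"
    using 0 p2 less_mult_imp_div_less [of i "p - 1" p] by (simp add: n_def)
  have "A (p * Suc n + r) = of_bool (r = 0)"
    using rec_digit [OF _ r, of "Suc n"] A_digit [OF _ n] by simp
  moreover have "A (p * n + r) = of_bool (r = 0)"
    using rec_digit [OF _ r, of n] A_digit [of n] A_digit [OF _ r] n 0 i by (cases "n = 0") auto
  moreover have "i + p ^ Suc 0 = p * Suc n + r"
    using i by simp
  ultimately show ?case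
    using i by metis
next
  case (Suc c)
  define n r where "n = i div p" and "r = i mod p"
  have i: "i = p * n + r" and r: "r < p"
    using p2 by (simp_all add: n_def r_def)
  have n: "p ^ c \<le> n" "n < (p - 1) * p ^ Suc c"
  proof -
    show "p ^ c \<le> n"
      using Suc.prems(1) p2 by (simp add: n_def less_eq_div_iff_mult_less_eq mult.commute)
    show "n < (p - 1) * p ^ Suc c"
      unfolding n_def using Suc.prems(2)
      by (intro less_mult_imp_div_less) (simp add: mult_ac)
  qed
  then have "0 < n"
    using p2 by (cases n) auto
  have "i + p ^ Suc (Suc c) = p * (n + p ^ Suc c) + r"
    by (simp add: i distrib_left)
  moreover have "A (p * n + r) = A (p * (n + p ^ Suc c) + r)"
    using rec_digit [OF \<open>0 < n\<close> r] rec_digit [OF _ r, of "n + p ^ Suc c"] Suc.IH [OF n] \<open>0 < n\<close>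
    by simp
  ultimately show ?case
    using i by metis
qed

lemma no_growing_block_map:
  assumes f: "block_map (\<lambda>n. A n mod p) f"
    and fixed: "\<And>i. i \<le> n \<Longrightarrow> f i = i" and grow: "Suc n < f (Suc n)"
  shows False
proof -
  define a where "a = (\<lambda>n. A n mod p)"
  have f: "block_map a f"
    unfolding a_def by (rule f)
  show False
  proof (cases "n \<le> 1")
    case True
    \<comment> \<open>For \<open>n \<le> 1\<close> the growing letter is among the first
      \<open>p\<close> letters, and the first \<open>p * p\<close> letters have period
      \<open>p\<close>. The power \<open>14\<close> serves the binary case; for
      \<open>p \<ge> 3\<close> only \<open>p < L\<close> is used.\<close>
    define g where "g = f ^^ 14"
    define L where "L = g p"
    have g: "block_map a g"
      unfolding g_def using f by (rule block_map_funpow)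
    have "Suc n + 14 \<le> g (Suc n)"
      unfolding g_def using block_map_strict_mono [OF f] grow by (rule funpow_growth)
    moreover have "g (Suc n) + (p - Suc n) \<le> g p"
      using strict_mono_add_le [OF block_map_strict_mono [OF g], of "Suc n" "p - Suc n"] True p2
      by simp
    ultimately have L: "p + 14 \<le> L"
      using True p2 unfolding L_def by linarith
    have small: "A i = of_bool (p dvd i)" if "i < p * p" for i
    proof -
      have "i div p < p"
        using that by (simp add: less_mult_imp_div_less)
      then show ?thesis
        using rec [of i] A_digit [of "i div p"] A_digit [of i] A_0 p2
        by (cases "i = 0"; cases "i < p")
          (auto simp: dvd_eq_mod_eq_0 div_greater_zero_iff)
    qed
    have pp: "p * (p - 1) + p = p * p"
      using p2 by (cases p) auto
    have per: "a (i + p) = a i" if "0 \<le> i" "i < p * (p - 1)" for i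
      using that small [of i] small [of "i + p"] pp by (simp add: a_def)
    have g0: "g 0 = 0"
      by (rule block_map_0 [OF g])
    have shift: "g (x + p) = g x + L" if "x \<le> p * (p - 1)" for x
      using block_map_period(1) [OF g, of 0 "p * (p - 1)" p x] per that g0 by (simp add: L_def)
    have mult: "g (p * j) = j * L" if "j \<le> p - 1" for j
      using that
    proof (induction j)
      case (Suc j)
      then have "g (p * j + p) = g (p * j) + L"
        by (intro shift mult_le_mono2) simp
      then show ?case
        using Suc by (simp add: add.commute)
    qed (simp add: g0)
    have perL: "A (i + L) mod p = A i mod p" if "i < (p - 1) * L" for i
      using block_map_period(2) [OF g, of 0 "p * (p - 1)" p i] per that mult [of "p - 1"] g0
      by (simp add: a_def L_def)
    consider "p = 2" | "3 \<le> p"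
      using p2 by linarith
    then show False
    proof cases
      case 1
      show False
        by (rule no_prefix_period_binary [OF 1 _ perL]) (use L 1 in auto)
    next
      case 2
      have eq: "(p - 1) * L = L + (p - 2) * L"
      proof -
        have "p - 1 = Suc (p - 2)"
          using 2 by simp
        then show ?thesis
          by (simp only: mult_Suc)
      qed
      show False
        by (rule no_long_period [OF 2, of 0 L]) (use L eq perL in auto)
    qed
  next
    case False
    define c where "c = a n"
    have grow_at: "Suc (f m) < f (Suc m)" if "a m = c" for m
      using block_map_letter(1) [OF f, of m n] that grow fixed [of n] by (simp add: c_def)
    \<comment> \<open>The letters \<open>1\<close> and \<open>0\<close> stand at the positions
      \<open>0\<close> and \<open>1\<close>, whose images are single letters, so neither is the
      growing letter.\<close>
    have c: "2 \<le> c"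
    proof (rule ccontr)
      assume "\<not> 2 \<le> c"
      then have "c = 0 \<or> c = 1"
        by linarith
      moreover have "a 1 = 0" "a 0 = 1"
        using A_0 A_digit [of 1] p2 by (simp_all add: a_def)
      ultimately have "Suc (f 1) < f (Suc 1) \<or> Suc (f 0) < f (Suc 0)"
        using grow_at by metis
      then show False
        using fixed [of 0] fixed [of 1] fixed [of 2] False by (auto simp: numeral_2_eq_2)
    qed
    have "c < p" "c \<le> A n"
      using p2 by (simp_all add: c_def a_def)
    then have p: "3 \<le> p"
      using c by linarith
    \<comment> \<open>A positive number with at least \<open>c\<close> zeros is at least
      \<open>p ^ c\<close>, so \<open>f\<close> fixes all indices up to
      \<open>p ^ c\<close>.\<close>
    have "p ^ c \<le> p ^ A n"
      using \<open>c \<le> A n\<close> p2 by (intro power_increasing) auto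
    also have "\<dots> \<le> n"
      using False by (intro power_count_le) simp
    finally have pc: "p ^ c \<le> n" .
    obtain d where d: "c = Suc d"
      using c by (cases c) auto
    define s where "s = p ^ d"
    define e where "e = p ^ c"
    have e: "e = p * s" "0 < s"
      using p2 by (simp_all add: e_def s_def d)
    then have se: "s < e"
      using p2 by simp
    define u where "u = (p - 1) * e"
    define L where "L = f (s + e) - f s"
    have per: "a (i + e) = a i" if "s \<le> i" "i < u" for i
      using A_add_power [of d i] that by (simp add: a_def s_def e_def u_def d)
    have shift: "f (x + e) = f x + L" if "s \<le> x" "x \<le> u" for x
      unfolding L_def using block_map_period(1) [OF f, of s u e x] per that by blast
    have periodic: "a (i + L) = a i" if "f s \<le> i" "i < f u" for i
      unfolding L_def using block_map_period(2) [OF f, of s u e i] per that by blast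
    have fe: "f s = s" "f e = e"
      using fixed pc se by (simp_all add: e_def)
    have je: "f (Suc j * e) = e + j * L" if "j \<le> p - 2" for j
      using that
    proof (induction j)
      case 0
      then show ?case
        using fe by simp
    next
      case (Suc j)
      have "Suc j * e \<le> u"
        unfolding u_def using Suc.prems by (intro mult_le_mono1) linarith
      moreover have "s \<le> Suc j * e"
        using se by simp
      ultimately have "f (Suc j * e + e) = f (Suc j * e) + L"
        by (intro shift)
      then show ?case
        using Suc by (simp add: algebra_simps)
    qed
    \<comment> \<open>The letter at \<open>e = p ^ c\<close> is \<open>c\<close> itself, so its
      image is longer than one letter. It is one of the \<open>e\<close> letters from
      \<open>e\<close> on, whose images have total length \<open>L\<close>.\<close>
    have "e < L"
    proof -
      have "a e = c"
        using A_power [of d] \<open>c < p\<close> by (simp add: a_def e_def d)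
      then have "Suc e < f (Suc e)"
        using grow_at [of e] fe by simp
      moreover have "f (Suc e) + (e - 1) \<le> f (Suc e + (e - 1))"
        by (rule strict_mono_add_le [OF block_map_strict_mono [OF f]])
      moreover have "f (Suc e + (e - 1)) = e + L"
      proof -
        have "Suc e + (e - 1) = Suc 1 * e"
          using se by simp
        then show ?thesis
          using je [of 1] p by (simp only:)
      qed
      ultimately show ?thesis
        using se by linarith
    qed
    have "f u = e + (p - 2) * L"
    proof -
      have "Suc (p - 2) = p - 1"
        using p by simp
      then show ?thesis
        using je [of "p - 2"] by (simp add: u_def)
    qed
    then have "A (i + L) mod p = A i mod p" if "s \<le> i" "i < e + (p - 2) * L" for i
      using periodic [of i] that fe by (simp add: a_def)
    then show False
      using no_long_period [OF p, of d L] \<open>e < L\<close> by (simp add: e_def s_def d)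
  qed
qed

end

section \<open>Purely morphic block sequences\<close>

lemma block_seq_not_purely_morphic:
  assumes "prime p" "w \<noteq> []" "set w \<subseteq> {0..<p}" "w = [0] \<or> 2 \<le> length w"
  shows "\<not> purely_morphic (alphabet p) (block_seq p w)"
proof
  have p2: "2 \<le> p"
    using assms(1) prime_ge_2_nat by blast
  assume "purely_morphic (alphabet p) (block_seq p w)"
  then have "purely_morphic (alphabet p) (smap (\<lambda>n. block_count p w n mod p) nats)"
    by (simp only: block_seq_def)
  from purely_morphic_block_map [OF this] obtain f n
    where f: "block_map (\<lambda>n. block_count p w n mod p) f"
      "\<And>i. i \<le> n \<Longrightarrow> f i = i" "Suc n < f (Suc n)"
    by blast
  show False
  proof (cases "2 \<le> length w")
    case True
    interpret block_recurrence p "length w" "digits_value p w" "block_count p w"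
    proof
      fix i
      assume i: "p ^ (length w - 1) \<le> i"
      have "p ^ 1 \<le> p ^ (length w - 1)"
        using True p2 by (intro power_increasing) auto
      then have "p \<le> i"
        using i by simp
      then show "block_count p w i = block_count p w (i div p)
          + of_bool (i mod p ^ length w = digits_value p w)"
        using block_count_ge [OF p2 _ assms(2,3)] i by simp
    qed (use assms True digits_value_less in auto)
    show False
      using f by (rule no_growing_block_map)
  next
    case False
    then have w: "w = [0]"
      using assms(4) by simp
    interpret zero_count p "block_count p w"
    proof
      fix i
      assume "p \<le> i"
      then show "block_count p w i = block_count p w (i div p) + of_bool (i mod p = 0)"
        using block_count_ge [OF p2 _ assms(2,3)] p2 by (simp add: w digits_value_def)
    qed (use p2 w in \<open>auto simp: block_count_less\<close>)
    show False
      using f by (rule no_growing_block_map)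
  qed
qed

theorem theorem2:
  fixes p :: nat and w :: "nat list"
  assumes "prime p" and "w \<noteq> []" and "set w \<subseteq> alphabet p"
  shows "uniformly_morphic p (alphabet p) (block_seq p w) \<and>
         (length w = 1 \<and> w \<noteq> [0] \<longrightarrow> purely_morphic (alphabet p) (block_seq p w)) \<and>
         (\<not> (length w = 1 \<and> w \<noteq> [0]) \<longrightarrow> \<not> purely_morphic (alphabet p) (block_seq p w))"
proof (intro conjI impI)
  have p2: "2 \<le> p"
    using assms(1) prime_ge_2_nat by blast
  have w: "set w \<subseteq> {0..<p}"
    using assms(3) by (simp add: alphabet_def)
  show "uniformly_morphic p (alphabet p) (block_seq p w)"
    using p2 assms(2) w by (rule block_seq_uniformly_morphic)
  show "purely_morphic (alphabet p) (block_seq p w)" if "length w = 1 \<and> w \<noteq> [0]"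
  proof -
    from that obtain z where "w = [z]" "z \<noteq> 0"
      by (auto simp: length_Suc_conv)
    then show ?thesis
      using single_letter_purely_morphic [OF p2, of z] w by simp
  qed
  show "\<not> purely_morphic (alphabet p) (block_seq p w)" if "\<not> (length w = 1 \<and> w \<noteq> [0])"
  proof (rule block_seq_not_purely_morphic [OF assms(1,2) w])
    show "w = [0] \<or> 2 \<le> length w"
      \<comment> \<open>The rule serves to split lists into those of length zero, one and at least
        two.\<close>
      using that assms(2) by (cases w rule: remdups_adj.cases) auto
  qed
qed

end
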